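(* Let $Z\subset\mathbb{P}^2_{\mathbb{C}}$ be a finite set of points such that at most 3 points of $Z$ are collinear (equivalently, the dual line arrangement $\mathcal{A}_Z$ satisfies $m(\mathcal{A}_Z)\leq 3$). Then $Z$ does not admit unexpected curves (of any degree). In particular, there are no unexpected cubics: no finite set $Z\subset\mathbb{P}^2_{\mathbb{C}}$ admits unexpected curves of degree 3.
   Context: Work over $\mathbb{C}$. A finite set $Z\subset\mathbb{P}^2$ admits unexpected curves of degree $j\geq 2$ if, for a generic point $q\in\mathbb{P}^2$ (i.e. for $q$ in a nonempty Zariski open subset), $$h^0(\mathbb{P}^2,\mathcal{O}_{\mathbb{P}^2}(j)\otimes\mathcal{I}(Z+(j-1)q))>\max\left(0,\ h^0(\mathbb{P}^2,\mathcal{O}_{\mathbb{P}^2}(j)\otimes\mathcal{I}(Z))-\binom{j}{2}\right),$$ where $\mathcal{I}(Z)$ is the ideal sheaf of functions vanishing on $Z$ and $\mathcal{I}(Z+(j-1)q)$ is the ideal sheaf of functions vanishing on $Z$ and vanishing to order $j-1$ at $q$. $\mathcal{A}_Z$ is the arrangement of the lines $ax+by+cz=0$ dual to the points $(a:b:c)\in Z$, and $m(\mathcal{A}_Z)$ is the maximal multiplicity of an intersection point of $\mathcal{A}_Z$, i.e. the maximal number of collinear points in $Z$. *)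

theory Defs
  imports "HOL-Analysis.Analysis" "HOL-Library.Poly_Mapping"
begin

section \<open>The complex projective plane\<close>

definition proportional :: "((complex^3) \<times> (complex^3)) set" where
  "proportional = {(u, v). u \<noteq> 0 \<and> v \<noteq> 0 \<and> (\<exists>c. v = c *s u)}"

text \<open>A point is a proportionality class of nonzero vectors, so \<open>coords p\<close> is the set of
  all homogeneous coordinate vectors of \<open>p\<close> (in particular \<open>0 \<notin> coords p\<close>).\<close>

typedef cp2 = "(- {0 :: complex^3}) // proportional"
  morphisms coords Cp2
proof
  show "proportional `` {1 :: complex^3} \<in> (- {0}) // proportional"
    by (rule quotientI) simp
qed

definition dual_line :: "cp2 \<Rightarrow> cp2 set" where
  "dual_line p = {x. \<forall>a\<in>coords p. \<forall>v\<in>coords x. (\<Sum>i\<in>UNIV. a $ i * v $ i) = 0}"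

text \<open>Every line of the plane has an equation \<open>a x + b y + c z = 0\<close> with
  \<open>(a, b, c) \<noteq> 0\<close>.\<close>

definition proj_lines :: "cp2 set set" where
  "proj_lines = range dual_line"

definition at_most_collinear :: "nat \<Rightarrow> cp2 set \<Rightarrow> bool" where
  "at_most_collinear k Z \<longleftrightarrow> (\<forall>l\<in>proj_lines. card (Z \<inter> l) \<le> k)"

definition dual_arrangement :: "cp2 set \<Rightarrow> cp2 set set" where
  "dual_arrangement Z = dual_line ` Z"

definition intersection_points :: "cp2 set set \<Rightarrow> cp2 set" where
  "intersection_points A = {x. \<exists>l\<in>A. \<exists>l'\<in>A. l \<noteq> l' \<and> x \<in> l \<and> x \<in> l'}"

definition point_mult :: "cp2 set set \<Rightarrow> cp2 \<Rightarrow> nat" where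
  "point_mult A x = card {l \<in> A. x \<in> l}"

text \<open>Since \<open>Sup {} = 0\<close> on \<^typ>\<open>nat\<close>, this is 0 for an arrangement of fewer than two
  lines, which has no intersection points.\<close>

definition max_mult :: "cp2 set set \<Rightarrow> nat" where
  "max_mult A = Sup (point_mult A ` intersection_points A)"


section \<open>Polynomials in three variables\<close>

text \<open>Finitely supported maps from exponent vectors to coefficients.\<close>

type_synonym tpoly = "(3 \<Rightarrow>\<^sub>0 nat) \<Rightarrow>\<^sub>0 complex"

definition mdeg :: "(3 \<Rightarrow>\<^sub>0 nat) \<Rightarrow> nat" where
  "mdeg \<alpha> = (\<Sum>i\<in>UNIV. Poly_Mapping.lookup \<alpha> i)"

definition form :: "nat \<Rightarrow> tpoly \<Rightarrow> bool" where
  "form d F \<longleftrightarrow> (\<forall>\<alpha>\<in>Poly_Mapping.keys F. mdeg \<alpha> = d)"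

definition peval :: "tpoly \<Rightarrow> complex^3 \<Rightarrow> complex" where
  "peval F v = (\<Sum>\<alpha>\<in>Poly_Mapping.keys F.
     Poly_Mapping.lookup F \<alpha> * (\<Prod>i\<in>UNIV. (v $ i) ^ Poly_Mapping.lookup \<alpha> i))"

text \<open>When the variable \<open>i\<close> does not occur in the monomial \<open>\<alpha>\<close>, the truncated exponent
  is harmless because the coefficient is 0.\<close>

definition pdiff :: "3 \<Rightarrow> tpoly \<Rightarrow> tpoly" where
  "pdiff i F = (\<Sum>\<alpha>\<in>Poly_Mapping.keys F.
     Poly_Mapping.single (\<alpha> - Poly_Mapping.single i 1)
       (of_nat (Poly_Mapping.lookup \<alpha> i) * Poly_Mapping.lookup F \<alpha>))"

definition tscale :: "complex \<Rightarrow> tpoly \<Rightarrow> tpoly" where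
  "tscale c F = Poly_Mapping.map ((*) c) F"

global_interpretation tp: vector_space tscale
  defines tdim = tp.dim
  by unfold_locales
    (simp_all add: tscale_def mult_map_scale_conv_mult algebra_simps single_add mult_single
      flip: mult.assoc single_one)

definition vanishes_at :: "tpoly \<Rightarrow> cp2 \<Rightarrow> bool" where
  "vanishes_at F p \<longleftrightarrow> (\<forall>v\<in>coords p. peval F v = 0)"

text \<open>\<open>F\<close> vanishes to order \<open>m\<close> at \<open>p\<close>: all iterated partial derivatives of order less
  than \<open>m\<close> vanish at \<open>p\<close>. For a form, differentiating in all three homogeneous variables
  gives the same condition as differentiating in two affine coordinates around \<open>p\<close>, by
  Euler's relation.\<close>

definition vanishes_to_order :: "nat \<Rightarrow> tpoly \<Rightarrow> cp2 \<Rightarrow> bool" where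
  "vanishes_to_order m F p \<longleftrightarrow>
     (\<forall>is. length is < m \<longrightarrow> vanishes_at (fold pdiff is F) p)"

definition zariski_open :: "cp2 set \<Rightarrow> bool" where
  "zariski_open U \<longleftrightarrow>
     (\<exists>S. (\<forall>F\<in>S. \<exists>d. form d F) \<and> - U = {p. \<forall>F\<in>S. vanishes_at F p})"


section \<open>Unexpected curves\<close>

text \<open>The global sections of \<open>O(j)\<close> on the plane are the forms of degree \<open>j\<close>. Hence the
  first space is \<open>H\<^sup>0\<close> of \<open>O(j) \<otimes> I(Z)\<close> and the second is \<open>H\<^sup>0\<close> of
  \<open>O(j) \<otimes> I(Z + m q)\<close>.\<close>

definition forms_through :: "nat \<Rightarrow> cp2 set \<Rightarrow> tpoly set" where
  "forms_through j Z = {F. form j F \<and> (\<forall>p\<in>Z. vanishes_at F p)}"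

definition forms_through_mult :: "nat \<Rightarrow> cp2 set \<Rightarrow> nat \<Rightarrow> cp2 \<Rightarrow> tpoly set" where
  "forms_through_mult j Z m q = {F \<in> forms_through j Z. vanishes_to_order m F q}"

definition admits_unexpected :: "cp2 set \<Rightarrow> nat \<Rightarrow> bool" where
  "admits_unexpected Z j \<longleftrightarrow> j \<ge> 2 \<and>
     (\<exists>U. zariski_open U \<and> U \<noteq> {} \<and>
       (\<forall>q\<in>U. int (tdim (forms_through_mult j Z (j - 1) q))
               > max 0 (int (tdim (forms_through j Z)) - int (j choose 2))))"

end

theory Submission
  imports Defs "HOL-Computational_Algebra.Polynomial_Factorial" "HOL-Computational_Algebra.Field_as_Ring"
begin

text \<open>
  Choose affine coordinates such that \<open>Z\<close> consists of points \<open>(x, y)\<close> with distinct \<open>x\<close>. A form of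
  degree \<open>r + 1\<close> with multiplicity \<open>r\<close> at \<open>q = (s, t)\<close> is given by two polynomials \<open>A\<close>, \<open>B\<close> in the
  slope \<open>\<kappa>\<close> of the lines through \<open>q\<close>, of degrees \<open>r\<close> and \<open>r + 1\<close>, and passing through \<open>(x, y)\<close>
  means \<open>(x - s) B + A = 0\<close> at one slope. If \<open>Z\<close> admits unexpected curves, linear algebra produces a
  nonzero pair with \<open>2 r + 3 \<le> |Z|\<close> for generic \<open>q\<close>, which can be chosen polynomial in \<open>(s, t)\<close>.

  In the dual coordinates \<open>\<kappa>\<close>, \<open>\<mu> = t - \<kappa> s\<close> the pair becomes a vector field along the line dual to
  \<open>q\<close>. The Wronskian of the pair with its derivative along \<open>s\<close> has degree at most \<open>2 r + 2\<close> and
  \<open>|Z|\<close> zeros, so the direction of the vector field does not depend on \<open>q\<close> (the descent argument of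
  the Grauert-Mulich theorem). Thus there is a vector field of degree \<open>r\<close> on the dual plane that is
  tangent to the lines dual to \<open>Z\<close>.

  On such a line the field vanishes at the intersections with the other lines. As at most three lines
  meet in a point, there are at least \<open>r + 1\<close> of them, and more than \<open>r + 1\<close> force the field to
  vanish on the line. If there are exactly \<open>r + 1\<close>, all are triple points, where the linear part of the
  field is scalar; comparing its two eigenvalues (a Camacho-Sad index computation) again gives zero.
  So the field vanishes on \<open>2 r + 3\<close> lines, hence everywhere.
\<close>

section \<open>Polynomials in two and three variables\<close>

text \<open>The outer variable takes the value \<open>s\<close>, the inner one \<open>t\<close>.
  Hence \<open>pderiv\<close> is the partial derivative in the first argument and
  \<open>map_poly pderiv\<close> the one in the second.\<close>

definition ev2 :: "complex poly poly \<Rightarrow> complex \<Rightarrow> complex \<Rightarrow> complex" where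
  "ev2 p s t = poly (poly p [:s:]) t"

definition ev3 :: "complex poly poly poly \<Rightarrow> complex \<Rightarrow> complex \<Rightarrow> complex \<Rightarrow> complex" where
  "ev3 p u s t = ev2 (poly p [:[:u:]:]) s t"

lemma ev2_simps [simp]:
  "ev2 0 s t = 0" "ev2 1 s t = 1" "ev2 (p + q) s t = ev2 p s t + ev2 q s t"
  "ev2 (p - q) s t = ev2 p s t - ev2 q s t" "ev2 (- p) s t = - ev2 p s t"
  "ev2 (p * q) s t = ev2 p s t * ev2 q s t" "ev2 (p ^ n) s t = ev2 p s t ^ n"
  "ev2 (pCons c p) s t = poly c t + s * ev2 p s t"
  by (simp_all add: ev2_def)

lemma ev2_sum [simp]: "ev2 (sum f A) s t = (\<Sum>x\<in>A. ev2 (f x) s t)"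
  by (simp add: ev2_def poly_sum)

lemma ev2_prod [simp]: "ev2 (prod f A) s t = (\<Prod>x\<in>A. ev2 (f x) s t)"
  by (simp add: ev2_def poly_prod)

lemma ev3_simps [simp]:
  "ev3 0 u s t = 0" "ev3 1 u s t = 1" "ev3 (p + q) u s t = ev3 p u s t + ev3 q u s t"
  "ev3 (p - q) u s t = ev3 p u s t - ev3 q u s t" "ev3 (- p) u s t = - ev3 p u s t"
  "ev3 (p * q) u s t = ev3 p u s t * ev3 q u s t" "ev3 (p ^ n) u s t = ev3 p u s t ^ n"
  "ev3 (pCons c p) u s t = ev2 c s t + u * ev3 p u s t"
  by (simp_all add: ev3_def del: mult_pCons_left)

text \<open>The constants form an infinite subset of the coefficient ring, so they cannot all be
  among the finitely many roots. Applied one variable at a time, this identifies nested polynomials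
  with their functions.\<close>

lemma poly_nonzero_at_const:
  fixes p :: "'a::idom poly" and c :: "complex \<Rightarrow> 'a"
  assumes "p \<noteq> 0" "inj c"
  shows "\<exists>s. poly p (c s) \<noteq> 0"
proof (rule ccontr)
  assume "\<not> ?thesis"
  then have "range c \<subseteq> {x. poly p x = 0}" by auto
  then have "finite (range c)" using poly_roots_finite[OF assms(1)] finite_subset by blast
  then show False using assms(2) by (simp add: finite_image_iff infinite_UNIV_char_0)
qed

lemma ev2_nonzero: "p \<noteq> 0 \<Longrightarrow> \<exists>s t. ev2 p s t \<noteq> 0"
  using poly_nonzero_at_const[of p "\<lambda>s. [:s:]"] poly_nonzero_at_const[of _ "\<lambda>s. s"]
  by (force simp: ev2_def inj_def)

lemma ev3_nonzero: "p \<noteq> 0 \<Longrightarrow> \<exists>u s t. ev3 p u s t \<noteq> 0"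
  using poly_nonzero_at_const[of p "\<lambda>s. [:[:s:]:]"] ev2_nonzero
  by (force simp: ev3_def inj_def)

lemma ev2_eq_0I: "(\<And>s t. ev2 p s t = 0) \<Longrightarrow> p = 0"
  using ev2_nonzero by blast

lemma ev3_eq_0I: "(\<And>u s t. ev3 p u s t = 0) \<Longrightarrow> p = 0"
  using ev3_nonzero by blast

lemma map_poly_pderiv_pCons: "map_poly pderiv (pCons c p) = pCons (pderiv c) (map_poly pderiv p)"
  for p :: "complex poly poly"
  by (rule map_poly_pCons) simp

text \<open>The chain rule is needed because polynomials in \<mu> and \<kappa> are differentiated
  along and across the moving lines \<open>\<mu> = t - \<kappa> * s\<close>.\<close>

lemma ev2_chain:
  assumes u: "(u has_field_derivative u') (at z)" and v: "(v has_field_derivative v') (at z)"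
  shows "((\<lambda>z. ev2 p (u z) (v z)) has_field_derivative
    ev2 (pderiv p) (u z) (v z) * u' + ev2 (map_poly pderiv p) (u z) (v z) * v') (at z)"
proof (induction p)
  case 0
  then show ?case by simp
next
  case (pCons c p)
  have "((\<lambda>z. poly c (v z)) has_field_derivative poly (pderiv c) (v z) * v') (at z)"
    by (rule DERIV_chain2[OF poly_DERIV v])
  from DERIV_add[OF this DERIV_mult[OF u pCons.IH]]
  show ?case
    by (simp add: map_poly_pderiv_pCons pderiv_pCons algebra_simps)
qed

lemma ev3_DERIV:
  "((\<lambda>u. ev3 p u s t) has_field_derivative ev3 (pderiv p) u s t) (at u)"
proof (induction p)
  case (pCons c p)
  from DERIV_add[OF DERIV_const[of "ev2 c s t"] DERIV_mult[OF DERIV_ident pCons.IH]]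
  show ?case by (simp add: pderiv_pCons algebra_simps)
qed simp

text \<open>Closure of these functions under substitution replaces the explicit composition of
  nested polynomials; a witness is extracted only when coefficients, zero divisors or common factors
  matter.\<close>

definition polyfun3 :: "(complex \<Rightarrow> complex \<Rightarrow> complex \<Rightarrow> complex) \<Rightarrow> bool" where
  "polyfun3 f \<longleftrightarrow> (\<exists>p. \<forall>u s t. f u s t = ev3 p u s t)"

lemma polyfun3_var:
  "polyfun3 (\<lambda>u s t. c)" "polyfun3 (\<lambda>u s t. u)" "polyfun3 (\<lambda>u s t. s)" "polyfun3 (\<lambda>u s t. t)"
  unfolding polyfun3_def
  by (rule exI[of _ "[:[:[:c:]:]:]"], simp, rule exI[of _ "[:0,1:]"], simp,
    rule exI[of _ "[:[:0,1:]:]"], simp, rule exI[of _ "[:[:[:0,1:]:]:]"], simp)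

lemma polyfun3_op:
  assumes "polyfun3 f" "polyfun3 g"
  shows "polyfun3 (\<lambda>u s t. f u s t + g u s t)" "polyfun3 (\<lambda>u s t. f u s t - g u s t)"
    "polyfun3 (\<lambda>u s t. f u s t * g u s t)"
proof -
  from assms obtain p q where "\<forall>u s t. f u s t = ev3 p u s t" "\<forall>u s t. g u s t = ev3 q u s t"
    unfolding polyfun3_def by blast
  then show "polyfun3 (\<lambda>u s t. f u s t + g u s t)" "polyfun3 (\<lambda>u s t. f u s t - g u s t)"
    "polyfun3 (\<lambda>u s t. f u s t * g u s t)"
    unfolding polyfun3_def
    by (intro exI[of _ "p + q"], simp, intro exI[of _ "p - q"], simp, intro exI[of _ "p * q"], simp)
qed

lemma polyfun3_power: "polyfun3 f \<Longrightarrow> polyfun3 (\<lambda>u s t. f u s t ^ n)"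
  by (induction n) (simp_all add: polyfun3_var polyfun3_op)

lemma polyfun3_sum:
  "(\<And>k. k \<in> K \<Longrightarrow> polyfun3 (f k)) \<Longrightarrow> polyfun3 (\<lambda>u s t. \<Sum>k\<in>K. f k u s t)"
  by (induction K rule: infinite_finite_induct) (simp_all add: polyfun3_var polyfun3_op)

lemma polyfun3_poly: "polyfun3 f \<Longrightarrow> polyfun3 (\<lambda>u s t. poly p (f u s t))"
  by (induction p) (simp_all add: polyfun3_var polyfun3_op)

lemma polyfun3_ev2:
  "polyfun3 f \<Longrightarrow> polyfun3 g \<Longrightarrow> polyfun3 (\<lambda>u s t. ev2 p (f u s t) (g u s t))"
  by (induction p) (simp_all add: polyfun3_var polyfun3_op polyfun3_poly)

lemmas polyfun3_intros = polyfun3_var polyfun3_op polyfun3_power polyfun3_sum polyfun3_poly polyfun3_ev2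

section \<open>Coefficients, root counts and generic specialization\<close>

lemma ev3_coeff: "ev3 p u s t = (\<Sum>k\<le>degree p. ev2 (coeff p k) s t * u ^ k)"
  proof -
  have "ev2 ([:[:u:]:] ^ k) s t = u ^ k" for k by (simp add: ev2_def)
  then show ?thesis by (simp add: ev3_def poly_altdef[of p])
qed

lemma poly_eq_0_if_roots:
  fixes p :: "complex poly"
  assumes "degree p \<le> n" "finite S" "n < card S" "\<And>x. x \<in> S \<Longrightarrow> poly p x = 0"
  shows "p = 0"
proof (rule ccontr)
  assume "p \<noteq> 0"
  then have "card S \<le> degree p"
    using assms card_mono[OF poly_roots_finite[OF \<open>p \<noteq> 0\<close>], of S] card_poly_roots_bound[OF \<open>p \<noteq> 0\<close>]
    by (metis (mono_tags, lifting) le_trans mem_Collect_eq subsetI)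
  then show False using assms by simp
qed

definition lin_poly :: "nat \<Rightarrow> (nat \<Rightarrow> complex) \<Rightarrow> complex poly" where
  "lin_poly n c = (\<Sum>k\<le>n. monom (c k) k)"

lemma lin_poly [simp]: "poly (lin_poly n c) x = (\<Sum>k\<le>n. c k * x ^ k)"
  by (simp add: lin_poly_def poly_sum poly_monom)

lemma degree_lin_poly: "degree (lin_poly n c) \<le> n"
  unfolding lin_poly_def by (rule degree_sum_le) (auto intro: order.trans[OF degree_monom_le])

lemma coeff_lin_poly: "coeff (lin_poly n c) k = (if k \<le> n then c k else 0)"
  by (simp add: lin_poly_def coeff_sum)

text \<open>Fraction-free Gaussian elimination over the polynomials in \<open>s\<close> and
  \<open>t\<close>. Either it meets a zero row, which yields a relation with polynomial
  coefficients, or the product \<open>c\<close> of the pivots certifies independence wherever it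
  does not vanish.\<close>

lemma generic_independence:
  fixes v :: "'k \<Rightarrow> 'i \<Rightarrow> complex poly poly"
  assumes "finite K"
  shows "(\<exists>a. (\<exists>k\<in>K. a k \<noteq> 0) \<and> (\<forall>i\<in>I. (\<Sum>k\<in>K. a k * v k i) = 0)) \<or>
    (\<exists>c. c \<noteq> 0 \<and> (\<forall>s t x. ev2 c s t \<noteq> 0 \<longrightarrow> (\<forall>i\<in>I. (\<Sum>k\<in>K. x k * ev2 (v k i) s t) = 0) \<longrightarrow>
      (\<forall>k\<in>K. x k = 0)))"
  using assms
proof (induction K arbitrary: v rule: finite_induct)
  case empty
  show ?case by (intro disjI2 exI[of _ 1]) auto
next
  case (insert m K)
  show ?case
  proof (cases "\<forall>i\<in>I. v m i = 0")
    case True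
    have "\<exists>a. (\<exists>k\<in>insert m K. a k \<noteq> 0) \<and> (\<forall>i\<in>I. (\<Sum>k\<in>insert m K. a k * v k i) = 0)"
      using True insert.hyps
      by (intro exI[of _ "\<lambda>k. if k = m then 1 else 0"]) (auto intro!: sum.neutral)
    then show ?thesis by blast
  next
    case False
    then obtain j where j: "j \<in> I" "v m j \<noteq> 0" by blast
    \<comment> \<open>\<open>v m j\<close> is the pivot; the combination clears column
      \<open>j\<close> of row \<open>k\<close> without division.\<close>
    define w where "w k i = v m j * v k i - v k j * v m i" for k i
    from insert.IH[of w] show ?thesis
    proof (elim disjE exE conjE)
      fix a assume a: "\<exists>k\<in>K. a k \<noteq> 0" "\<forall>i\<in>I. (\<Sum>k\<in>K. a k * w k i) = 0"
      define b where "b k = (if k = m then - (\<Sum>k\<in>K. a k * v k j) else a k * v m j)" for k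
      have "(\<Sum>k\<in>insert m K. b k * v k i) = 0" if "i \<in> I" for i
      proof -
        have "(\<Sum>k\<in>K. b k * v k i) = (\<Sum>k\<in>K. a k * v m j * v k i)"
          using insert.hyps by (intro sum.cong) (auto simp: b_def)
        then have "(\<Sum>k\<in>insert m K. b k * v k i) = (\<Sum>k\<in>K. a k * w k i)"
          using insert.hyps
          by (simp add: b_def w_def algebra_simps sum_subtractf sum_distrib_left sum_distrib_right)
        then show ?thesis using a that by simp
      qed
      moreover have "\<exists>k\<in>insert m K. b k \<noteq> 0"
        using a(1) j insert.hyps by (auto simp: b_def)
      ultimately show ?thesis by blast
    next
      fix c assume c: "c \<noteq> 0" and ind: "\<forall>s t x. ev2 c s t \<noteq> 0 \<longrightarrow>
        (\<forall>i\<in>I. (\<Sum>k\<in>K. x k * ev2 (w k i) s t) = 0) \<longrightarrow> (\<forall>k\<in>K. x k = 0)"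
      have "\<forall>k\<in>insert m K. x k = 0"
        if g: "ev2 (c * v m j) s t \<noteq> 0" and z: "\<forall>i\<in>I. (\<Sum>k\<in>insert m K. x k * ev2 (v k i) s t) = 0"
        for s t x
      proof -
        let ?e = "\<lambda>p. ev2 p s t"
        have zz: "x m * ?e (v m i) + (\<Sum>k\<in>K. x k * ?e (v k i)) = 0" if "i \<in> I" for i
          using z that insert.hyps by simp
        have "(\<Sum>k\<in>K. x k * ?e (w k i)) = 0" if "i \<in> I" for i
        proof -
          have "(\<Sum>k\<in>K. x k * ?e (w k i)) = ?e (v m j) * (\<Sum>k\<in>K. x k * ?e (v k i))
              - (\<Sum>k\<in>K. x k * ?e (v k j)) * ?e (v m i)"
            by (simp add: w_def algebra_simps sum_subtractf sum_distrib_left sum_distrib_right)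
          also have "\<dots> = ?e (v m j) * (- x m * ?e (v m i)) - (- x m * ?e (v m j)) * ?e (v m i)"
            using zz[OF that] zz[OF j(1)] by (simp add: add_eq_0_iff)
          finally show ?thesis by (simp add: algebra_simps)
        qed
        then have K: "\<forall>k\<in>K. x k = 0" using ind g by auto
        then have "x m * ?e (v m j) = 0" using zz[OF j(1)] by simp
        then show ?thesis using g K by auto
      qed
      then show ?thesis using c j by (intro disjI2 exI[of _ "c * v m j"]) auto
    qed
  qed
qed

text \<open>The product with \<open>h\<close> vanishes everywhere, and polynomial rings have no zero
  divisors.\<close>

lemma polyfun3_generic_zero:
  assumes "polyfun3 f" "h \<noteq> 0" "\<And>k s t. ev2 h s t \<noteq> 0 \<Longrightarrow> f k s t = 0"
  shows "f k s t = 0"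
proof -
  obtain p where p: "\<And>k s t. f k s t = ev3 p k s t" using assms(1) unfolding polyfun3_def by blast
  have "p * [:h:] = 0" 
  proof (rule ev3_eq_0I)
    fix u s t
    have "ev3 (p * [:h:]) u s t = f u s t * ev2 h s t" by (simp only: ev3_simps p) simp
    then show "ev3 (p * [:h:]) u s t = 0" using assms(3)[of s t u] by (cases "ev2 h s t = 0") auto
  qed
  then show ?thesis using assms(2) p by simp
qed

text \<open>The slopes are the \<kappa>-coordinates of the points where the line dual to
  \<open>(s, t)\<close> meets the lines dual to \<open>P\<close>. They are defined and distinct
  unless \<open>(s, t)\<close> lies on the vertical line through a point of \<open>P\<close> or on a
  line joining two of them; \<open>h\<close> is the product of the equations of these lines.\<close>

lemma generic_slopes:
  assumes "finite P" "inj_on fst (P :: (complex \<times> complex) set)"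
  shows "\<exists>h. h \<noteq> 0 \<and> (\<forall>s t. ev2 h s t \<noteq> 0 \<longrightarrow> (\<forall>(x, y)\<in>P. x \<noteq> s) \<and>
    inj_on (\<lambda>(x, y). (y - t) / (x - s)) P)"
proof -
  define X :: "complex \<times> complex \<Rightarrow> complex poly poly" where "X p = [:[:fst p:], -1:]" for p
  define Y :: "complex \<times> complex \<Rightarrow> complex poly poly" where "Y p = [:[:snd p, -1:]:]" for p
  define h where "h = (\<Prod>p\<in>P. X p) * (\<Prod>(p, q)\<in>{(p, q). p \<in> P \<and> q \<in> P \<and> p \<noteq> q}. Y p * X q - Y q * X p)"
  have fin2: "finite {(p, q). p \<in> P \<and> q \<in> P \<and> p \<noteq> q}"
    by (rule finite_subset[OF _ finite_cartesian_product[OF assms(1) assms(1)]]) auto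
  have ne0: "Y p * X q - Y q * X p \<noteq> 0" if "p \<in> P" "q \<in> P" "p \<noteq> q" for p q
  proof
    assume z: "Y p * X q - Y q * X p = 0"
    \<comment> \<open>One unit above \<open>p\<close> the expression reduces to
      \<open>fst p - fst q\<close>.\<close>
    have "ev2 (Y p * X q - Y q * X p) (fst p) (snd p + 1) = 0" using z by simp
    then have "fst p = fst q" by (simp add: X_def Y_def algebra_simps)
    then show False using that assms(2) by (auto simp: inj_on_def)
  qed
  have "(case z of (p, q) \<Rightarrow> Y p * X q - Y q * X p) \<noteq> 0"
    if "z \<in> {(p, q). p \<in> P \<and> q \<in> P \<and> p \<noteq> q}" for z
    using that ne0[of "fst z" "snd z"] by (simp only: mem_Collect_eq case_prod_beta simp_thms not_False_eq_True)
  then have "(\<Prod>(p, q)\<in>{(p, q). p \<in> P \<and> q \<in> P \<and> p \<noteq> q}. Y p * X q - Y q * X p) \<noteq> 0"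
    unfolding prod_zero_iff[OF fin2] by blast
  moreover have "(\<Prod>p\<in>P. X p) \<noteq> 0" using assms(1) by (simp add: X_def)
  ultimately have "h \<noteq> 0" unfolding h_def by simp
  moreover have "(\<forall>(x, y)\<in>P. x \<noteq> s) \<and> inj_on (\<lambda>(x, y). (y - t) / (x - s)) P" if "ev2 h s t \<noteq> 0" for s t
  proof -
    have x: "x \<noteq> s" if "(x, y) \<in> P" for x y
      using that \<open>ev2 h s t \<noteq> 0\<close> assms(1) unfolding h_def by (auto simp: X_def)
    have ne: "ev2 (Y p * X q - Y q * X p) s t \<noteq> 0" if "p \<in> P" "q \<in> P" "p \<noteq> q" for p q
    proof
      assume "ev2 (Y p * X q - Y q * X p) s t = 0"
      then have "(\<Prod>x\<in>{(p, q). p \<in> P \<and> q \<in> P \<and> p \<noteq> q}. ev2 (case x of (p, q) \<Rightarrow> Y p * X q - Y q * X p) s t) = 0"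
        using fin2 that by (intro prod_zero bexI[of _ "(p, q)"]) auto
      then have "ev2 h s t = 0" unfolding h_def ev2_simps ev2_prod by simp
      with \<open>ev2 h s t \<noteq> 0\<close> show False by simp
    qed
    have "inj_on (\<lambda>(x, y). (y - t) / (x - s)) P"
    proof (rule inj_onI, rule ccontr)
      fix p q assume pq: "p \<in> P" "q \<in> P" "p \<noteq> q"
        and e: "(case p of (x, y) \<Rightarrow> (y - t) / (x - s)) = (case q of (x, y) \<Rightarrow> (y - t) / (x - s))"
      obtain x y x' y' where c: "p = (x, y)" "q = (x', y')" by (cases p, cases q)
      have "(y - t) * (x' - s) = (y' - t) * (x - s)"
        using e x[of x y] x[of x' y'] pq unfolding c by (simp add: frac_eq_eq)
      moreover have "ev2 (Y p * X q - Y q * X p) s t = (y - t) * (x' - s) - (y' - t) * (x - s)"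
        by (simp add: X_def Y_def c algebra_simps)
      ultimately show False using ne[OF pq] by simp
    qed
    then show ?thesis using x by auto
  qed
  ultimately show ?thesis by blast
qed

section \<open>Vector fields tangent to lines\<close>

text \<open>The lines \<open>\<mu> = y - \<kappa> x\<close> for \<open>(x, y) \<in> P\<close> in the \<open>(\<kappa>, \<mu>)\<close>-plane are dual to the
  points of \<open>P\<close>; the pair \<open>(al, be)\<close> is the vector field \<open>be \<partial>\<^sub>\<kappa> + al \<partial>\<^sub>\<mu>\<close>. At a triple
  point its linear part preserves three directions, hence is scalar.\<close>

lemma tangent_field_zero:
  fixes P :: "(complex \<times> complex) set" and al be :: "complex poly poly"
    and a b :: "nat \<Rightarrow> complex poly poly"
  assumes fin: "finite P" and inj: "inj_on fst P" and r: "1 \<le> r" "2 * r + 3 \<le> card P"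
    and col: "\<And>k m. card {(x, y) \<in> P. y = k * x + m} \<le> 3"
    and tan: "\<And>x y k. (x, y) \<in> P \<Longrightarrow> ev2 al (y - k * x) k + x * ev2 be (y - k * x) k = 0"
    and ab: "\<And>s t k. ev2 al (t - k * s) k + s * ev2 be (t - k * s) k = (\<Sum>i\<le>r. ev2 (a i) s t * k ^ i)"
    and b: "\<And>s t k. ev2 be (t - k * s) k = (\<Sum>i\<le>Suc r. ev2 (b i) s t * k ^ i)"
  shows "al = 0 \<and> be = 0"
proof -
  define alm bem alk bek where d: "alm = ev2 (pderiv al)" "bem = ev2 (pderiv be)"
    "alk = ev2 (map_poly pderiv al)" "bek = ev2 (map_poly pderiv be)"
  \<comment> \<open>\<open>K\<close> is the derivative of \<open>al + s * be\<close> transverse to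
    the line dual to \<open>(s, t)\<close>, and \<open>W\<close> below is the \<kappa>-component of
    the field on it. At a zero on a line that is tangent to the field, \<open>K\<close> and the
    derivative of \<open>W\<close> are the normal and the tangential eigenvalue.\<close>
  define K where "K s t = lin_poly r (\<lambda>i. ev2 (map_poly pderiv (a i)) s t)" for s t
  define W where "W s t = lin_poly (Suc r) (\<lambda>i. ev2 (b i) s t)" for s t
  have W: "poly (W s t) k = ev2 be (t - k * s) k" for s t k
    by (simp add: W_def b del: sum.atMost_Suc)
  have K: "poly (K s t) k = alm (t - k * s) k + s * bem (t - k * s) k" for s t k
  proof -
    have "((\<lambda>t. ev2 al (t - k * s) k + s * ev2 be (t - k * s) k) has_field_derivative
       alm (t - k * s) k + s * bem (t - k * s) k) (at t)"
      unfolding d by (auto intro!: derivative_eq_intros ev2_chain[THEN DERIV_cong])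
    moreover have "((\<lambda>t. \<Sum>i\<le>r. ev2 (a i) s t * k ^ i) has_field_derivative poly (K s t) k) (at t)"
      unfolding K_def lin_poly
      by (rule DERIV_sum) (auto intro!: derivative_eq_intros ev2_chain[THEN DERIV_cong])
    ultimately show ?thesis by (simp add: ab DERIV_unique)
  qed
  \<comment> \<open>The derivative in \<open>s\<close> equals \<open>W - k * K\<close>. Its degree
    is at most \<open>r\<close>, although each of the two terms may have degree
    \<open>r + 1\<close>; this plays the part of the residue relation in the index
    computation.\<close>
  define L where "L s t = lin_poly r (\<lambda>i. ev2 (pderiv (a i)) s t)" for s t
  have L: "poly (L s t) k = poly (W s t) k - k * poly (K s t) k" for s t k
  proof -
    have "((\<lambda>s. ev2 al (t - k * s) k + s * ev2 be (t - k * s) k) has_field_derivative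
       - k * alm (t - k * s) k + (ev2 be (t - k * s) k - s * k * bem (t - k * s) k)) (at s)"
      unfolding d by (auto intro!: derivative_eq_intros ev2_chain[THEN DERIV_cong])
    moreover have "((\<lambda>s. \<Sum>i\<le>r. ev2 (a i) s t * k ^ i) has_field_derivative poly (L s t) k) (at s)"
      unfolding L_def lin_poly
      by (rule DERIV_sum) (auto intro!: derivative_eq_intros ev2_chain[THEN DERIV_cong])
    ultimately have "poly (L s t) k = - k * alm (t - k * s) k + (ev2 be (t - k * s) k - s * k * bem (t - k * s) k)"
      by (simp add: ab DERIV_unique)
    then show ?thesis by (simp add: W K algebra_simps)
  qed
  have L': "L s t = W s t - pCons 0 (K s t)" for s t
    by (subst poly_eq_poly_eq_iff[symmetric]) (simp add: L fun_eq_iff)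
  have W': "poly (pderiv (W x y)) k = bek (y - k * x) k - x * bem (y - k * x) k" for x y k
  proof -
    have "((\<lambda>k. ev2 be (y - k * x) k) has_field_derivative
      bek (y - k * x) k - x * bem (y - k * x) k) (at k)"
      unfolding d by (auto intro!: derivative_eq_intros ev2_chain[THEN DERIV_cong])
    moreover have "((\<lambda>k. ev2 be (y - k * x) k) has_field_derivative poly (pderiv (W x y)) k) (at k)"
      unfolding W[symmetric] by (rule poly_DERIV)
    ultimately show ?thesis by (rule DERIV_unique[symmetric])
  qed
  \<comment> \<open>The tangency is differentiated along the line. At a zero of the field this says
    that the linear part preserves the direction of the line: \<open>x\<close> is a root of a
    quadratic polynomial built from the linear part.\<close>
  have quad: "alk (y - k * x) k + x * (bek (y - k * x) k - alm (y - k * x) k) - x\<^sup>2 * bem (y - k * x) k = 0"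
    if "(x, y) \<in> P" for x y k
  proof -
    have "((\<lambda>k. ev2 al (y - k * x) k + x * ev2 be (y - k * x) k) has_field_derivative
      alk (y - k * x) k - x * alm (y - k * x) k + x * (bek (y - k * x) k - x * bem (y - k * x) k)) (at k)"
      unfolding d by (auto intro!: derivative_eq_intros ev2_chain[THEN DERIV_cong])
    moreover have "((\<lambda>k. ev2 al (y - k * x) k + x * ev2 be (y - k * x) k) has_field_derivative 0) (at k)"
      by (simp add: tan[OF that])
    ultimately have "alk (y - k * x) k - x * alm (y - k * x) k + x * (bek (y - k * x) k - x * bem (y - k * x) k) = 0"
      by (rule DERIV_unique)
    then show ?thesis by (simp add: algebra_simps power2_eq_square)
  qed
  have W0: "W x y = 0" if p: "(x, y) \<in> P" for x y
  proof -
    define sl where "sl = (\<lambda>(x', y'). (y' - y) / (x' - x))"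
    define Q where "Q = P - {(x, y)}"
    have finQ: "finite Q" using fin unfolding Q_def by (rule finite_Diff)
    have cQ: "Suc (card Q) = card P" unfolding Q_def by (rule card_Suc_Diff1[OF fin p])
    have xne: "x' \<noteq> x" if "(x', y') \<in> Q" for x' y'
      using that p inj_onD[OF inj, of "(x', y')" "(x, y)"] by (auto simp: Q_def)
    have sl: "y' - k * x' = y - k * x" if "(x', y') \<in> Q" "sl (x', y') = k" for x' y' k
      using xne[OF that(1)] that(2) unfolding sl_def by (auto simp: field_simps)
    \<comment> \<open>These are the other lines through the point with coordinate \<open>k\<close>;
      in the plane of \<open>P\<close> they are the other points on the line of slope
      \<open>k\<close> through \<open>(x, y)\<close>.\<close>
    define fib where "fib k = {q \<in> Q. sl q = k}" for k
    have fib: "card (fib k) \<le> 2" for k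
    proof -
      have "insert (x, y) (fib k) \<subseteq> {(x', y') \<in> P. y' = k * x' + (y - k * x)}"
        using p sl by (auto simp: fib_def Q_def algebra_simps)
      then have "card (insert (x, y) (fib k)) \<le> card {(x', y') \<in> P. y' = k * x' + (y - k * x)}"
        by (rule card_mono[rotated]) (auto intro: finite_subset[OF _ fin])
      also have "\<dots> \<le> 3" by (rule col)
      finally have "card (insert (x, y) (fib k)) \<le> 3" .
      moreover have "(x, y) \<notin> fib k" "finite (fib k)" using finQ by (auto simp: fib_def Q_def)
      ultimately show ?thesis by simp
    qed
    have cQs: "card Q = (\<Sum>k\<in>sl ` Q. card (fib k))"
      unfolding fib_def card_eq_sum by (rule sum.image_gen[OF finQ])
    \<comment> \<open>Where two lines of different directions meet, the field is tangent to both and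
      therefore zero.\<close>
    have root: "poly (W x y) k = 0" if "k \<in> sl ` Q" for k
    proof -
      from that obtain x' y' where q: "(x', y') \<in> Q" "sl (x', y') = k" by auto
      have "ev2 al (y - k * x) k + x' * ev2 be (y - k * x) k = 0"
        using tan[of x' y' k] q sl[OF q] by (auto simp: Q_def)
      moreover have "ev2 al (y - k * x) k + x * ev2 be (y - k * x) k = 0" using tan[OF p] .
      moreover have "(x' - x) * ev2 be (y - k * x) k = (ev2 al (y - k * x) k + x' * ev2 be (y - k * x) k)
          - (ev2 al (y - k * x) k + x * ev2 be (y - k * x) k)"
        by (simp add: algebra_simps)
      ultimately have "(x' - x) * ev2 be (y - k * x) k = 0" by simp
      then show ?thesis using xne[OF q(1)] by (simp add: W)
    qed
    have degW: "degree (W x y) \<le> Suc r" unfolding W_def by (rule degree_lin_poly)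
    \<comment> \<open>There are at least \<open>2 * r + 2\<close> other lines, at most two through
      each intersection point.\<close>
    have "card Q \<le> (\<Sum>k\<in>sl ` Q. 2)" unfolding cQs by (rule sum_mono) (rule fib)
    then have ge: "r + 1 \<le> card (sl ` Q)" using r cQ by simp
    show ?thesis
    proof (cases "card (sl ` Q) = r + 1")
      case False
      then show ?thesis
        using ge finQ root by (intro poly_eq_0_if_roots[OF degW, of "sl ` Q"]) auto
    next
      case True
      \<comment> \<open>Equality in the count leaves only triple points on the line.\<close>
      have full: "card (fib k) = 2" if k: "k \<in> sl ` Q" for k
      proof (rule ccontr)
        assume "card (fib k) \<noteq> 2"
        then have "card (fib k) < 2" using fib[of k] by simp
        then have "(\<Sum>k\<in>sl ` Q. card (fib k)) < (\<Sum>k\<in>sl ` Q. 2)"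
          using k finQ fib by (intro sum_strict_mono_ex1) auto
        then show False using cQs True r cQ by simp
      qed
      \<comment> \<open>Three distinct roots annihilate the quadratic polynomial, so the linear part
        is scalar and its tangential and normal eigenvalues agree.\<close>
      have WK: "poly (pderiv (W x y) - K x y) k = 0" if k: "k \<in> sl ` Q" for k
      proof -
        obtain p1 p2 where "fib k = {p1, p2}" "p1 \<noteq> p2" using full[OF k] by (auto simp: card_2_iff)
        then obtain x1 y1 x2 y2 where f: "(x1, y1) \<in> fib k" "(x2, y2) \<in> fib k" "(x1, y1) \<noteq> (x2, y2)"
          by (metis insert_iff surj_pair)
        then have ne: "x1 \<noteq> x" "x2 \<noteq> x" "x1 \<noteq> x2"
          using xne inj unfolding fib_def inj_on_def Q_def by fastforce+
        define A B C where abc: "A = alk (y - k * x) k" "B = bek (y - k * x) k - alm (y - k * x) k"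
          "C = bem (y - k * x) k"
        have "A + x1 * B - x1\<^sup>2 * C = 0" "A + x2 * B - x2\<^sup>2 * C = 0" "A + x * B - x\<^sup>2 * C = 0"
          using quad[of x1 y1 k] quad[of x2 y2 k] quad[OF p, of k] f sl[of x1 y1 k] sl[of x2 y2 k]
          by (auto simp: abc fib_def Q_def)
        moreover have "(z - x) * (B - (z + x) * C) = (A + z * B - z\<^sup>2 * C) - (A + x * B - x\<^sup>2 * C)" for z
          by (simp add: algebra_simps power2_eq_square)
        ultimately have e: "(x1 - x) * (B - (x1 + x) * C) = 0" "(x2 - x) * (B - (x2 + x) * C) = 0"
          by simp_all
        then have B: "B = (x1 + x) * C" "B = (x2 + x) * C" using ne by auto
        have "(x1 + x) * C = (x2 + x) * C" unfolding B(1)[symmetric] by (rule B(2))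
        then have "C = 0" using ne(3) by auto
        with B have "B = 0" by simp
        then show ?thesis using \<open>C = 0\<close> by (simp add: W' K abc)
      qed
      have "degree (pderiv (W x y) - K x y) \<le> r"
        using degW degree_lin_poly[of r] unfolding K_def
        by (intro degree_diff_le) (auto simp: degree_pderiv)
      then have "pderiv (W x y) - K x y = 0"
        using True WK finQ by (intro poly_eq_0_if_roots[of _ r "sl ` Q"]) auto
      then have "K x y = pderiv (W x y)" by simp
      then have "L x y = W x y - pCons 0 (pderiv (W x y))" using L' by simp
      \<comment> \<open>At index \<open>r + 1\<close> the left side is 0 and the right side is
        \<open>- r\<close> times the coefficient of \<open>W\<close>. This is where
        \<open>1 \<le> r\<close> enters.\<close>
      then have "coeff (L x y) (Suc r) = coeff (W x y) (Suc r) - of_nat (Suc r) * coeff (W x y) (Suc r)"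
        by (simp add: coeff_pderiv)
      moreover have "coeff (L x y) (Suc r) = 0" by (simp add: L_def coeff_lin_poly)
      ultimately have "of_nat r * coeff (W x y) (Suc r) = 0" by (simp add: algebra_simps)
      then have "coeff (W x y) (Suc r) = 0" using r by simp
      then have "degree (W x y) \<le> r"
        by (intro degree_le) (metis Suc_lessI W_def coeff_lin_poly not_le)
      then show ?thesis using True finQ root by (intro poly_eq_0_if_roots[of _ r "sl ` Q"]) auto
    qed
  qed
  have be0: "ev2 be (y - k * x) k = 0" if "(x, y) \<in> P" for x y k
    using W0[OF that] W[of x y k] by simp
  have al0: "ev2 al (y - k * x) k = 0" if "(x, y) \<in> P" for x y k
    using tan[OF that, of k] be0[OF that] by simp
  obtain h where h: "h \<noteq> 0" "\<And>s t. ev2 h s t \<noteq> 0 \<Longrightarrow> (\<forall>(x, y)\<in>P. x \<noteq> s) \<and>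
      inj_on (\<lambda>(x, y). (y - t) / (x - s)) P"
    using generic_slopes[OF fin inj] by blast
  \<comment> \<open>A generic line meets the lines dual to \<open>P\<close> in at least
    \<open>2 * r + 3\<close> distinct points, more than the degree of \<open>W\<close>
    allows.\<close>
  have Wg: "W s t = 0" if "ev2 h s t \<noteq> 0" for s t
  proof -
    let ?sl = "\<lambda>(x, y). (y - t) / (x - s)"
    from h(2)[OF that] have x: "\<And>x y. (x, y) \<in> P \<Longrightarrow> x \<noteq> s" and i: "inj_on ?sl P" by auto
    have "poly (W s t) k = 0" if "k \<in> ?sl ` P" for k
    proof -
      from that obtain x' y' where q: "(x', y') \<in> P" "k = (y' - t) / (x' - s)" by auto
      then have "t - k * s = y' - k * x'" using x[OF q(1)] by (simp add: field_simps)
      then show ?thesis using be0[OF q(1)] by (simp add: W)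
    qed
    then show ?thesis using i r fin degree_lin_poly[of "Suc r"] card_image[OF i]
      by (intro poly_eq_0_if_roots[of _ "Suc r" "?sl ` P"]) (auto simp: W_def)
  qed
  have be_gen: "ev2 be (t - k * s) k = 0" if "ev2 h s t \<noteq> 0" for k s t
    using Wg[OF that] W[of s t k] by simp
  have beg: "ev2 be (t - k * s) k = 0" for k s t
    by (rule polyfun3_generic_zero[OF _ h(1), of "\<lambda>k s t. ev2 be (t - k * s) k"])
      (auto intro!: polyfun3_intros simp: be_gen)
  have "be = 0" by (rule ev2_eq_0I) (use beg[where s = 0] in simp)
  moreover have "ev2 al m k = 0" for m k
  proof -
    have alg: "ev2 al (t - k * s) k = 0" if g: "ev2 h s t \<noteq> 0" for s t k
    proof -
      let ?sl = "\<lambda>(x, y). (y - t) / (x - s)"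
      define A where "A = lin_poly r (\<lambda>i. ev2 (a i) s t)"
      have A: "poly A k = ev2 al (t - k * s) k" for k
        using ab[of t k s] \<open>be = 0\<close> by (simp add: A_def)
      from h(2)[OF g] have x: "\<And>x y. (x, y) \<in> P \<Longrightarrow> x \<noteq> s" and i: "inj_on ?sl P" by auto
      have "poly A k = 0" if "k \<in> ?sl ` P" for k
      proof -
        from that obtain x' y' where q: "(x', y') \<in> P" "k = (y' - t) / (x' - s)" by auto
        then have "t - k * s = y' - k * x'" using x[OF q(1)] by (simp add: field_simps)
        then show ?thesis using al0[OF q(1)] by (simp add: A)
      qed
      then have "A = 0" using i r fin degree_lin_poly[of r] card_image[OF i]
        by (intro poly_eq_0_if_roots[of _ r "?sl ` P"]) (auto simp: A_def)
      then show ?thesis using A[of k] by simp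
    qed
    have "ev2 al (t - k * s) k = 0" for k s t
      by (rule polyfun3_generic_zero[OF _ h(1), of "\<lambda>k s t. ev2 al (t - k * s) k"])
        (auto intro!: polyfun3_intros simp: alg)
    from this[of m k 0] show ?thesis by simp
  qed
  then have "al = 0" by (rule ev2_eq_0I)
  ultimately show ?thesis by simp
qed

section \<open>Descent of a family of pencil sections\<close>

lemma polyfun3_ev3:
  "polyfun3 f \<Longrightarrow> polyfun3 g \<Longrightarrow> polyfun3 h \<Longrightarrow>
    polyfun3 (\<lambda>u s t. ev3 p (f u s t) (g u s t) (h u s t))"
  by (induction p) (simp_all add: polyfun3_intros)

lemma polyfun3_mult_zero:
  assumes "polyfun3 f" "polyfun3 g" "\<And>u s t. f u s t * g u s t = 0"
  shows "(\<forall>u s t. f u s t = 0) \<or> (\<forall>u s t. g u s t = 0)"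
proof -
  obtain p q where pq: "\<forall>u s t. f u s t = ev3 p u s t" "\<forall>u s t. g u s t = ev3 q u s t"
    using assms unfolding polyfun3_def by blast
  have "p * q = 0" by (rule ev3_eq_0I) (use assms(3) pq in simp)
  then show ?thesis using pq by auto
qed

lemma eq_lin_poly: "degree p \<le> n \<Longrightarrow> p = lin_poly n (coeff p)"
  by (rule poly_eqI) (auto simp: coeff_lin_poly coeff_eq_0)

lemma polyfun3_restrict:
  assumes "polyfun3 f"
  shows "\<exists>p. \<forall>u. poly p u = f u s t"
proof -
  obtain Q where "\<And>u s t. f u s t = ev3 Q u s t" using assms unfolding polyfun3_def by blast
  then show ?thesis
    by (intro exI[of _ "lin_poly (degree Q) (\<lambda>i. ev2 (coeff Q i) s t)"]) (simp add: ev3_coeff)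
qed

text \<open>Every coefficient of index above \<open>n\<close> vanishes at generic
  \<open>(s, t)\<close> and hence identically, so a degree bound on generic lines holds for the
  whole family.\<close>

lemma coeff_family:
  assumes "polyfun3 f" "h \<noteq> 0"
    and deg: "\<And>s t. ev2 h s t \<noteq> 0 \<Longrightarrow> \<exists>p. degree p \<le> n \<and> (\<forall>k. poly p k = f k s t)"
  shows "\<exists>c. \<forall>k s t. f k s t = (\<Sum>i\<le>n. ev2 (c i) s t * k ^ i)"
proof -
  obtain Q where Q: "\<And>k s t. f k s t = ev3 Q k s t" using assms unfolding polyfun3_def by blast
  have "coeff Q i = 0" if "i > n" for i
  proof (rule ccontr)
    assume n0: "coeff Q i \<noteq> 0"
    then have "coeff Q i * h \<noteq> 0" using assms by simp
    then obtain s t where st: "ev2 (coeff Q i * h) s t \<noteq> 0" using ev2_nonzero by blast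
    then have "ev2 h s t \<noteq> 0" by simp
    from deg[OF this] obtain p where p: "degree p \<le> n" "\<And>k. poly p k = f k s t" by blast
    have "p = lin_poly (degree Q) (\<lambda>i. ev2 (coeff Q i) s t)"
      by (subst poly_eq_poly_eq_iff[symmetric]) (simp add: fun_eq_iff p Q ev3_coeff)
    then have "coeff p i = ev2 (coeff Q i) s t"
      using le_degree[OF n0] by (simp add: coeff_lin_poly)
    then show False using p(1) that st by (simp add: coeff_eq_0)
  qed
  then have "degree Q \<le> n" by (intro degree_le) auto
  then have "(\<Sum>i\<le>degree Q. ev2 (coeff Q i) s t * k ^ i) = (\<Sum>i\<le>n. ev2 (coeff Q i) s t * k ^ i)" for k s t
    by (intro sum.mono_neutral_left) (auto simp: coeff_eq_0)
  then show ?thesis using Q by (intro exI[of _ "coeff Q"]) (simp add: ev3_coeff)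
qed

text \<open>This serves to exchange a factor depending on the base point for a product of line
  equations.\<close>

lemma degree_mult_swap:
  fixes g c d :: "complex poly"
  assumes "g \<noteq> 0" "degree d \<le> degree g" "degree (g * c) \<le> n"
  shows "degree (d * c) \<le> n"
proof (cases "c = 0")
  case False
  then have "degree g + degree c \<le> n" using assms by (simp add: degree_mult_eq)
  then show ?thesis using degree_mult_le[of d c] assms(2) by linarith
qed simp

text \<open>Differentiation lowers the degree in the outer variable, so the divisibility is possible
  only if the derivative is zero.\<close>

lemma pderiv_dvd_self:
  fixes p :: "complex poly poly poly"
  assumes "p dvd pderiv p"
  shows "\<exists>c. p = [:c:]"
proof -
  have "pderiv p = 0"
  proof (rule ccontr)
    assume n: "pderiv p \<noteq> 0"
    then have "degree p \<le> degree (pderiv p)" using assms dvd_imp_degree_le by blast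
    then have "degree p = 0" by (simp add: degree_pderiv)
    then show False using n pderiv_eq_0_iff by blast
  qed
  then have "degree p = 0" using pderiv_eq_0_iff by blast
  then show ?thesis by (rule degree_eq_zeroE) blast
qed

text \<open>For fixed \<open>m\<close> and \<open>k\<close> the point \<open>(s, m + k * s)\<close>
  moves along the line \<open>y = k * x + m\<close>, so the pair becomes a family of vector fields
  with parameter \<open>s\<close>. Its Wronskian in \<open>s\<close> has more roots than its degree
  permits, so the direction of the field is constant. The factor still depending on \<open>s\<close>
  is then exchanged for line equations, which keeps the tangency and the degree bounds.\<close>

lemma descent:
  fixes P :: "(complex \<times> complex) set" and a b :: "nat \<Rightarrow> complex poly poly" and r :: nat
  defines "A k s t \<equiv> (\<Sum>i\<le>r. ev2 (a i) s t * k ^ i)"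
    and "B k s t \<equiv> (\<Sum>i\<le>Suc r. ev2 (b i) s t * k ^ i)"
  assumes fin: "finite P" and inj: "inj_on fst P" and r: "2 * r + 3 \<le> card P"
    and nz: "(\<exists>i\<le>r. a i \<noteq> 0) \<or> (\<exists>i\<le>Suc r. b i \<noteq> 0)"
    and rel: "\<And>x y s t k. (x, y) \<in> P \<Longrightarrow> x \<noteq> s \<Longrightarrow> y - t = k * (x - s) \<Longrightarrow>
      (x - s) * B k s t + A k s t = 0"
  shows "\<exists>al be a' b'. (al \<noteq> 0 \<or> be \<noteq> 0) \<and>
    (\<forall>(x, y)\<in>P. \<forall>k. ev2 al (y - k * x) k + x * ev2 be (y - k * x) k = 0) \<and>
    (\<forall>s t k. ev2 al (t - k * s) k + s * ev2 be (t - k * s) k = (\<Sum>i\<le>r. ev2 (a' i) s t * k ^ i)) \<and>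
    (\<forall>s t k. ev2 be (t - k * s) k = (\<Sum>i\<le>Suc r. ev2 (b' i) s t * k ^ i))"
proof -
  have pfA: "polyfun3 f \<Longrightarrow> polyfun3 g \<Longrightarrow> polyfun3 h \<Longrightarrow>
      polyfun3 (\<lambda>u s t. A (f u s t) (g u s t) (h u s t))"
    and pfB: "polyfun3 f \<Longrightarrow> polyfun3 g \<Longrightarrow> polyfun3 h \<Longrightarrow>
      polyfun3 (\<lambda>u s t. B (f u s t) (g u s t) (h u s t))" for f g h
    unfolding A_def B_def by (intro polyfun3_intros; assumption)+
  \<comment> \<open>With \<open>t = m + k * s\<close>, these are the components of the field along
    \<mu> and \<kappa>.\<close>
  have "polyfun3 (\<lambda>s m k. A k s (m + k * s) - s * B k s (m + k * s))"
    "polyfun3 (\<lambda>s m k. B k s (m + k * s))"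
    by (intro polyfun3_intros pfA pfB)+
  then obtain PA PB where PA: "\<And>s m k. ev3 PA s m k = A k s (m + k * s) - s * B k s (m + k * s)"
    and PB: "\<And>s m k. ev3 PB s m k = B k s (m + k * s)"
    unfolding polyfun3_def by metis
  have tan: "ev3 PA s (y - k * x) k + x * ev3 PB s (y - k * x) k = 0" if p: "(x, y) \<in> P" for x y s k
  proof (rule polyfun3_generic_zero[of "\<lambda>k s t. ev3 PA s (y - k * x) k + x * ev3 PB s (y - k * x) k" "[:[:x:], -1:]"])
    show "polyfun3 (\<lambda>k s t. ev3 PA s (y - k * x) k + x * ev3 PB s (y - k * x) k)"
      by (intro polyfun3_intros polyfun3_ev3)
    fix k s t :: complex
    assume "ev2 [:[:x:], -1:] s t \<noteq> 0"
    then show "ev3 PA s (y - k * x) k + x * ev3 PB s (y - k * x) k = 0"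
      using rel[OF p, of s "y - k * x + k * s" k] by (auto simp: PA PB algebra_simps)
  qed simp
  have tan': "ev3 (pderiv PA) s (y - k * x) k + x * ev3 (pderiv PB) s (y - k * x) k = 0"
    if p: "(x, y) \<in> P" for x y s k
  proof -
    have "((\<lambda>s. ev3 PA s (y - k * x) k + x * ev3 PB s (y - k * x) k) has_field_derivative
      ev3 (pderiv PA) s (y - k * x) k + x * ev3 (pderiv PB) s (y - k * x) k) (at s)"
      by (auto intro!: derivative_eq_intros ev3_DERIV[THEN DERIV_cong])
    moreover have "((\<lambda>s. ev3 PA s (y - k * x) k + x * ev3 PB s (y - k * x) k) has_field_derivative 0) (at s)"
      by (simp add: tan[OF p])
    ultimately show ?thesis by (rule DERIV_unique)
  qed
  obtain h where h: "h \<noteq> 0" "\<And>s t. ev2 h s t \<noteq> 0 \<Longrightarrow> (\<forall>(x, y)\<in>P. x \<noteq> s) \<and>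
      inj_on (\<lambda>(x, y). (y - t) / (x - s)) P"
    using generic_slopes[OF fin inj] by blast
  define D where "D = PA * pderiv PB - PB * pderiv PA"
  text \<open>On a line through a point \<open>(s, t)\<close> the Wronskian has degree at most \<open>2 r + 2\<close>, but it
    vanishes at the intersections with the \<open>2 r + 3\<close> lines.\<close>
  have "D = 0"
  proof -
    have line: "\<exists>p. degree p \<le> 2 * r + 2 \<and> (\<forall>k. poly p k = ev3 D s (t - k * s) k)" for s t
    proof -
      define pA where "pA = lin_poly r (\<lambda>i. ev2 (a i) s t)"
      define pB where "pB = lin_poly (Suc r) (\<lambda>i. ev2 (b i) s t)"
      define A' where "A' = lin_poly r (\<lambda>i. ev2 (pderiv (a i)) s t) + pCons 0 (lin_poly r (\<lambda>i. ev2 (map_poly pderiv (a i)) s t))"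
      define B' where "B' = lin_poly (Suc r) (\<lambda>i. ev2 (pderiv (b i)) s t) + pCons 0 (lin_poly (Suc r) (\<lambda>i. ev2 (map_poly pderiv (b i)) s t))"
      have dg: "degree pA \<le> r" "degree pB \<le> Suc r" "degree A' \<le> Suc r" "degree B' \<le> Suc (Suc r)"
        unfolding pA_def pB_def A'_def B'_def
        by (intro degree_lin_poly degree_add_le order.trans[OF degree_pCons_le]; simp add: degree_lin_poly le_SucI)+
      have dA: "((\<lambda>s'. A k s' (t - k * s + k * s')) has_field_derivative poly A' k) (at s)" for k
        unfolding A_def A'_def poly_add poly_pCons lin_poly sum_distrib_left add_0 sum.distrib[symmetric]
        by (rule DERIV_sum) (auto intro!: derivative_eq_intros ev2_chain[THEN DERIV_cong] simp: algebra_simps)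
      have dB: "((\<lambda>s'. B k s' (t - k * s + k * s')) has_field_derivative poly B' k) (at s)" for k
        unfolding B_def B'_def poly_add poly_pCons lin_poly sum_distrib_left add_0 sum.distrib[symmetric]
        by (rule DERIV_sum) (auto intro!: derivative_eq_intros ev2_chain[THEN DERIV_cong] simp: algebra_simps)
      have B1: "ev3 (pderiv PB) s (t - k * s) k = poly B' k" for k
        by (rule DERIV_unique[OF ev3_DERIV]) (unfold PB, rule dB)
      have A1: "ev3 (pderiv PA) s (t - k * s) k = poly A' k - (poly pB k + s * poly B' k)" for k
      proof (rule DERIV_unique[OF ev3_DERIV])
        have "poly pB k = B k s t" by (simp add: pB_def B_def del: sum.atMost_Suc)
        then show "((\<lambda>u. ev3 PA u (t - k * s) k) has_field_derivative poly A' k - (poly pB k + s * poly B' k)) (at s)"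
          unfolding PA by (auto intro!: derivative_eq_intros dA dB)
      qed
      have AB: "poly pB k = ev3 PB s (t - k * s) k" "poly pA k - s * poly pB k = ev3 PA s (t - k * s) k" for k
        by (simp_all add: pA_def pB_def A_def B_def PA PB del: sum.atMost_Suc)
      \<comment> \<open>The terms carrying the factor \<open>s\<close> cancel, and each of the three
        remaining products has degree at most \<open>2 * r + 2\<close>.\<close>
      have "poly (pA * B' - pB * A' + pB * pB) k = ev3 D s (t - k * s) k" for k
        unfolding D_def ev3_simps A1 B1 AB[symmetric] by (simp add: algebra_simps)
      moreover have "degree (pA * B' - pB * A' + pB * pB) \<le> 2 * r + 2"
        using dg by (intro degree_add_le degree_diff_le; intro order.trans[OF degree_mult_le]) auto
      ultimately show ?thesis by blast
    qed
    have gen: "ev3 D s (t - k * s) k = 0" if g: "ev2 h s t \<noteq> 0" for s t k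
    proof -
      let ?sl = "\<lambda>(x, y). (y - t) / (x - s)"
      obtain p where p: "degree p \<le> 2 * r + 2" "\<And>k. poly p k = ev3 D s (t - k * s) k"
        using line by blast
      from h(2)[OF g] have x: "\<And>x y. (x, y) \<in> P \<Longrightarrow> x \<noteq> s" and i: "inj_on ?sl P" by auto
      have "poly p k = 0" if "k \<in> ?sl ` P" for k
      proof -
        from that obtain x y where q: "(x, y) \<in> P" "k = (y - t) / (x - s)" by auto
        then have m: "t - k * s = y - k * x" using x[OF q(1)] by (simp add: field_simps)
        have "ev3 PA s (y - k * x) k = - x * ev3 PB s (y - k * x) k"
          "ev3 (pderiv PA) s (y - k * x) k = - x * ev3 (pderiv PB) s (y - k * x) k"
          using tan[OF q(1), of s k] tan'[OF q(1), of s k] by (simp_all add: eq_neg_iff_add_eq_0)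
        then show ?thesis unfolding p m D_def by simp
      qed
      then have "p = 0" using i r fin p card_image[OF i]
        by (intro poly_eq_0_if_roots[of _ "2 * r + 2" "?sl ` P"]) auto
      then show ?thesis using p(2)[of k] by simp
    qed
    have all: "ev3 D s (t - k * s) k = 0" for s t k
      by (rule polyfun3_generic_zero[OF _ h(1), of "\<lambda>k s t. ev3 D s (t - k * s) k"])
        (auto intro!: polyfun3_intros polyfun3_ev3 simp: gen)
    show ?thesis
    proof (rule ev3_eq_0I)
      show "ev3 D s m k = 0" for s m k using all[of s "m + k * s" k] by simp
    qed
  qed
  have nz': "PA \<noteq> 0 \<or> PB \<noteq> 0"
  proof (rule ccontr)
    assume "\<not> ?thesis"
    then have "B k s t = 0" "A k s t = 0" for k s t
      using PB[of s "t - k * s" k] PA[of s "t - k * s" k] by auto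
    then have "lin_poly r (\<lambda>i. ev2 (a i) s t) = 0" "lin_poly (Suc r) (\<lambda>i. ev2 (b i) s t) = 0" for s t
      by (auto simp: A_def B_def fun_eq_iff simp del: sum.atMost_Suc simp flip: poly_eq_poly_eq_iff)
    then have "i \<le> r \<Longrightarrow> ev2 (a i) s t = 0" "i \<le> Suc r \<Longrightarrow> ev2 (b i) s t = 0" for s t i
      by (metis coeff_lin_poly coeff_0)+
    then show False using nz ev2_eq_0I by blast
  qed
  \<comment> \<open>After division by the gcd, the vanishing Wronskian makes each coprime cofactor
    divide its own derivative, so neither depends on \<open>s\<close>.\<close>
  define G where "G = gcd PA PB"
  have G0: "G \<noteq> 0" using nz' by (simp add: G_def)
  obtain A0 B0 where AB0: "PA = A0 * G" "PB = B0 * G" "coprime A0 B0"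
    using gcd_coprime_exists[of PA PB] G0 unfolding G_def by blast
  have "G * G * (A0 * pderiv B0 - B0 * pderiv A0) = D"
    by (simp add: D_def AB0 pderiv_mult algebra_simps)
  then have eq: "A0 * pderiv B0 = B0 * pderiv A0" using \<open>D = 0\<close> G0 by simp
  have "A0 dvd B0 * pderiv A0" by (metis eq dvd_triv_left)
  then have "A0 dvd pderiv A0" using AB0(3) by (simp add: coprime_dvd_mult_right_iff)
  then obtain a0 where a0: "A0 = [:a0:]" using pderiv_dvd_self by blast
  have "B0 dvd A0 * pderiv B0" by (metis eq dvd_triv_left)
  then have "B0 dvd pderiv B0" using AB0(3) by (simp add: coprime_dvd_mult_right_iff coprime_commute)
  then obtain b0 where b0: "B0 = [:b0:]" using pderiv_dvd_self by blast
  have ev: "ev3 PA s m k = ev2 a0 m k * ev3 G s m k" "ev3 PB s m k = ev2 b0 m k * ev3 G s m k" for s m k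
    unfolding AB0 a0 b0 ev3_simps by simp_all
  \<comment> \<open>The reduced field \<open>(a0, b0)\<close> may fail to be tangent to some lines;
    on those \<open>G\<close> vanishes for every \<open>s\<close>.\<close>
  define I where "I = {(x, y) \<in> P. \<exists>k. ev2 a0 (y - k * x) k + x * ev2 b0 (y - k * x) k \<noteq> 0}"
  have finI: "finite I" using fin unfolding I_def by (rule finite_subset[rotated]) auto
  have GI: "ev3 G s (y - k * x) k = 0" if "(x, y) \<in> I" for x y s k
  proof -
    have p: "(x, y) \<in> P" using that by (simp add: I_def)
    define f where "f k s t = ev2 a0 (y - k * x) k + x * ev2 b0 (y - k * x) k" for k s t :: complex
    define g where "g k s t = ev3 G s (y - k * x) k" for k s t :: complex
    have "(\<forall>k s t. f k s t = 0) \<or> (\<forall>k s t. g k s t = 0)"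
    proof (rule polyfun3_mult_zero)
      show "polyfun3 f" "polyfun3 g"
        unfolding f_def[abs_def] g_def[abs_def] by (intro polyfun3_intros polyfun3_ev3)+
      show "f k s t * g k s t = 0" for k s t
        using tan[OF p, of s k] by (simp add: ev algebra_simps f_def g_def)
    qed
    then have "(\<forall>k. ev2 a0 (y - k * x) k + x * ev2 b0 (y - k * x) k = 0) \<or>
      (\<forall>k s. ev3 G s (y - k * x) k = 0)"
      unfolding f_def g_def by blast
    then show ?thesis using that by (auto simp: I_def)
  qed
  \<comment> \<open>Multiplication by the equations of the lines in \<open>I\<close> restores the
    tangency.\<close>
  define Gam where "Gam = (\<Prod>(x, y)\<in>I. [:[:y, - x:], -1:] :: complex poly poly)"
  have Gam: "ev2 Gam m k = (\<Prod>(x, y)\<in>I. y - k * x - m)" for m k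
    unfolding Gam_def by (simp add: case_prod_beta)
  have Gam0: "Gam \<noteq> 0" unfolding Gam_def using finI by (auto simp: prod_zero_iff)
  define al be where "al = Gam * a0" and "be = Gam * b0"
  have albe: "al \<noteq> 0 \<or> be \<noteq> 0" using nz' Gam0 by (auto simp: al_def be_def AB0 a0 b0)
  have tn: "ev2 al (y - k * x) k + x * ev2 be (y - k * x) k = 0" if "(x, y) \<in> P" for x y k
  proof (cases "(x, y) \<in> I")
    case True
    then have "ev2 Gam (y - k * x) k = 0" unfolding Gam using finI by (intro prod_zero bexI[of _ "(x, y)"]) auto
    then show ?thesis by (simp add: al_def be_def)
  next
    case False
    then have "ev2 a0 (y - k * x) k + x * ev2 b0 (y - k * x) k = 0" using that by (auto simp: I_def)
    then have "ev2 Gam (y - k * x) k * (ev2 a0 (y - k * x) k + x * ev2 b0 (y - k * x) k) = 0" by simp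
    then show ?thesis by (simp add: al_def be_def algebra_simps)
  qed
  have "polyfun3 (\<lambda>k s t. ev3 G s (t - k * s) k)" by (intro polyfun3_intros polyfun3_ev3)
  then obtain Q where Q: "\<And>k s t. ev3 G s (t - k * s) k = ev3 Q k s t" unfolding polyfun3_def by blast
  have "Q \<noteq> 0"
  proof
    assume "Q = 0"
    then have "ev3 G s m k = 0" for s m k using Q[of s "m + k * s" k] by simp
    then show False using G0 ev3_eq_0I by blast
  qed
  \<comment> \<open>The leading coefficient in \<open>k\<close> keeps the restriction of
    \<open>G\<close> to a generic line nonzero.\<close>
  define h' where "h' = h * lead_coeff Q"
  have h': "h' \<noteq> 0" using h(1) \<open>Q \<noteq> 0\<close> by (simp add: h'_def)
  \<comment> \<open>On a generic line \<open>G\<close> has a root at each of the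
    \<open>card I\<close> distinct intersections, so its degree is at least that of
    \<open>Gam\<close>, and passing from \<open>G\<close> to \<open>Gam\<close> does not raise the
    bounds.\<close>
  have drop: "\<exists>p. degree p \<le> n \<and> (\<forall>k. poly p k = ev2 Gam (t - k * s) k * f k)"
    if g: "ev2 h' s t \<noteq> 0" and f: "\<exists>p. \<forall>k. poly p k = f k"
      and fG: "\<exists>p. degree p \<le> n \<and> (\<forall>k. poly p k = f k * ev3 G s (t - k * s) k)" for s t f n
  proof -
    let ?sl = "\<lambda>(x, y). (y - t) / (x - s)"
    obtain c where c: "\<And>k. poly c k = f k" using f by blast
    obtain q where q: "degree q \<le> n" "\<And>k. poly q k = f k * ev3 G s (t - k * s) k" using fG by blast
    define gp where "gp = lin_poly (degree Q) (\<lambda>i. ev2 (coeff Q i) s t)"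
    have gp: "poly gp k = ev3 G s (t - k * s) k" for k by (simp add: gp_def Q ev3_coeff[of Q])
    have "coeff gp (degree Q) \<noteq> 0" using g by (simp add: gp_def coeff_lin_poly h'_def)
    then have gp0: "gp \<noteq> 0" by auto
    define d where "d = (\<Prod>(x, y)\<in>I. [:y - t, s - x:])"
    have d: "poly d k = ev2 Gam (t - k * s) k" for k
      unfolding Gam d_def poly_prod by (rule prod.cong) (auto simp: algebra_simps)
    have "ev2 h s t \<noteq> 0" using g by (simp add: h'_def)
    from h(2)[OF this] have x: "\<And>x y. (x, y) \<in> P \<Longrightarrow> x \<noteq> s" and i: "inj_on ?sl P" by auto
    have IP: "I \<subseteq> P" by (auto simp: I_def)
    have "?sl ` I \<subseteq> {k. poly gp k = 0}"
    proof safe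
      fix x y assume xy: "(x, y) \<in> I"
      define k where "k = (y - t) / (x - s)"
      have "t - k * s = y - k * x" using x[of x y] xy IP by (auto simp: k_def field_simps)
      then have "poly gp k = 0" using GI[OF xy, of s k] gp by simp
      then show "poly gp ((y - t) / (x - s)) = 0" by (simp add: k_def)
    qed
    then have "card (?sl ` I) \<le> card {k. poly gp k = 0}"
      by (intro card_mono poly_roots_finite gp0)
    also have "\<dots> \<le> degree gp" by (rule card_poly_roots_bound[OF gp0])
    finally have Igp: "card I \<le> degree gp" using card_image[OF inj_on_subset[OF i IP]] by simp
    have dI: "degree d \<le> card I"
    proof -
      have "degree d \<le> (\<Sum>z\<in>I. degree (case z of (x, y) \<Rightarrow> [:y - t, s - x:]))"
        unfolding d_def by (rule order.trans[OF degree_prod_sum_le[OF finI]]) (simp add: o_def)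
      also have "\<dots> \<le> (\<Sum>z\<in>I. 1)" by (rule sum_mono) auto
      finally show ?thesis by simp
    qed
    have gcq: "gp * c = q"
      by (subst poly_eq_poly_eq_iff[symmetric]) (simp add: fun_eq_iff gp c q)
    have "degree (d * c) \<le> n"
      by (rule degree_mult_swap[OF gp0 order.trans[OF dI Igp]]) (unfold gcq, rule q(1))
    then show ?thesis by (intro exI[of _ "d * c"]) (simp add: d c)
  qed
  have eb: "\<exists>c. \<forall>k s t. ev2 be (t - k * s) k = (\<Sum>i\<le>Suc r. ev2 (c i) s t * k ^ i)"
  proof (rule coeff_family[OF _ h'])
    fix s t assume g: "ev2 h' s t \<noteq> 0"
    have "\<exists>p. degree p \<le> Suc r \<and> (\<forall>k. poly p k = ev2 Gam (t - k * s) k * ev2 b0 (t - k * s) k)"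
    proof (rule drop[OF g])
      show "\<exists>p. \<forall>k. poly p k = ev2 b0 (t - k * s) k"
        by (rule polyfun3_restrict[of "\<lambda>k s t. ev2 b0 (t - k * s) k"]) (intro polyfun3_intros)
      show "\<exists>p. degree p \<le> Suc r \<and> (\<forall>k. poly p k = ev2 b0 (t - k * s) k * ev3 G s (t - k * s) k)"
        by (intro exI[of _ "lin_poly (Suc r) (\<lambda>i. ev2 (b i) s t)"])
          (simp add: degree_lin_poly ev[symmetric] PB B_def del: sum.atMost_Suc)
    qed
    then show "\<exists>p. degree p \<le> Suc r \<and> (\<forall>k. poly p k = ev2 be (t - k * s) k)" by (simp add: be_def)
  qed (intro polyfun3_intros)
  have ea: "\<exists>c. \<forall>k s t. ev2 al (t - k * s) k + s * ev2 be (t - k * s) k = (\<Sum>i\<le>r. ev2 (c i) s t * k ^ i)"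
  proof (rule coeff_family[OF _ h'])
    fix s t assume g: "ev2 h' s t \<noteq> 0"
    have "\<exists>p. degree p \<le> r \<and> (\<forall>k. poly p k = ev2 Gam (t - k * s) k * (ev2 a0 (t - k * s) k + s * ev2 b0 (t - k * s) k))"
    proof (rule drop[OF g])
      show "\<exists>p. \<forall>k. poly p k = ev2 a0 (t - k * s) k + s * ev2 b0 (t - k * s) k"
        by (rule polyfun3_restrict[of "\<lambda>k s t. ev2 a0 (t - k * s) k + s * ev2 b0 (t - k * s) k"])
          (intro polyfun3_intros)
      show "\<exists>p. degree p \<le> r \<and> (\<forall>k. poly p k = (ev2 a0 (t - k * s) k + s * ev2 b0 (t - k * s) k) * ev3 G s (t - k * s) k)"
        by (intro exI[of _ "lin_poly r (\<lambda>i. ev2 (a i) s t)"])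
          (simp add: degree_lin_poly distrib_right mult.assoc ev[symmetric] PA PB A_def del: sum.atMost_Suc)
    qed
    then show "\<exists>p. degree p \<le> r \<and> (\<forall>k. poly p k = ev2 al (t - k * s) k + s * ev2 be (t - k * s) k)"
      by (simp add: be_def al_def algebra_simps)
  qed (intro polyfun3_intros)
  from ea obtain a' where a': "\<forall>k s t. ev2 al (t - k * s) k + s * ev2 be (t - k * s) k = (\<Sum>i\<le>r. ev2 (a' i) s t * k ^ i)" ..
  from eb obtain b' where b': "\<forall>k s t. ev2 be (t - k * s) k = (\<Sum>i\<le>Suc r. ev2 (b' i) s t * k ^ i)" ..
  show ?thesis
    by (intro exI[of _ al] exI[of _ be] exI[of _ a'] exI[of _ b'] conjI albe)
      (use tn in fast, use a' in fast, use b' in fast)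
qed

text \<open>The incidence conditions are linear in the coefficients of \<open>A\<close> and
  \<open>B\<close>. Solvable at generic \<open>(s, t)\<close>, they have a solution polynomial in
  \<open>(s, t)\<close>; \<open>descent\<close> turns it into a nonzero field, which
  \<open>tangent_field_zero\<close> excludes.\<close>

lemma no_generic_section:
  fixes P :: "(complex \<times> complex) set"
  assumes fin: "finite P" and inj: "inj_on fst P" and r: "1 \<le> r" "2 * r + 3 \<le> card P"
    and col: "\<And>k m. card {(x, y) \<in> P. y = k * x + m} \<le> 3"
    and gen: "\<And>c. c \<noteq> 0 \<Longrightarrow> \<exists>s t A B. ev2 c s t \<noteq> 0 \<and> (A \<noteq> 0 \<or> B \<noteq> 0) \<and> degree A \<le> r \<and>
      degree B \<le> Suc r \<and> (\<forall>(x, y)\<in>P. x \<noteq> s \<and>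
        (x - s) * poly B ((y - t) / (x - s)) + poly A ((y - t) / (x - s)) = 0)"
  shows False
proof -
  define X :: "complex \<times> complex \<Rightarrow> complex poly poly" where "X p = [:[:fst p:], -1:]" for p
  define Y :: "complex \<times> complex \<Rightarrow> complex poly poly" where "Y p = [:[:snd p, -1:]:]" for p
  \<comment> \<open>These are the coefficients of the condition after multiplication by
    \<open>(x - s) ^ r\<close>; \<open>Inl\<close> indexes the coefficients of \<open>A\<close> and
    \<open>Inr\<close> those of \<open>B\<close>.\<close>
  define v where "v k p = (case k of Inl i \<Rightarrow> Y p ^ i * X p ^ (r - i) | Inr i \<Rightarrow> Y p ^ i * X p ^ (Suc r - i))" for k p
  have sc: "(\<Sum>i\<le>n. c i * (y ^ i * x ^ (n - i))) = x ^ n * (\<Sum>i\<le>n. c i * (y / x) ^ i)"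
    if "x \<noteq> 0" for n c and x y :: complex
    unfolding sum_distrib_left
    by (rule sum.cong) (use that in \<open>auto simp: power_divide power_diff\<close>)
  have sp: "(\<Sum>k\<in>{..r} <+> {..Suc r}. f k) = (\<Sum>i\<le>r. f (Inl i)) + (\<Sum>i\<le>Suc r. f (Inr i))"
    for f :: "nat + nat \<Rightarrow> 'z::comm_monoid_add"
    by (subst sum.Plus) (auto simp: o_def)
  have "finite ({..r} <+> {..Suc r})" by simp
  from generic_independence[OF this, of P v]
  show False
  proof (elim disjE exE conjE)
    fix a assume a: "\<exists>k\<in>{..r} <+> {..Suc r}. a k \<noteq> 0"
      "\<forall>p\<in>P. (\<Sum>k\<in>{..r} <+> {..Suc r}. a k * v k p) = 0"
    have "\<exists>al be a' b'. (al \<noteq> 0 \<or> be \<noteq> 0) \<and>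
      (\<forall>(x, y)\<in>P. \<forall>k. ev2 al (y - k * x) k + x * ev2 be (y - k * x) k = 0) \<and>
      (\<forall>s t k. ev2 al (t - k * s) k + s * ev2 be (t - k * s) k = (\<Sum>i\<le>r. ev2 (a' i) s t * k ^ i)) \<and>
      (\<forall>s t k. ev2 be (t - k * s) k = (\<Sum>i\<le>Suc r. ev2 (b' i) s t * k ^ i))"
    proof (rule descent[OF fin inj r(2), of "\<lambda>i. a (Inl i)" "\<lambda>i. a (Inr i)"])
      show "(\<exists>i\<le>r. a (Inl i) \<noteq> 0) \<or> (\<exists>i\<le>Suc r. a (Inr i) \<noteq> 0)" using a(1) by auto
      fix x y s t k :: complex
      assume xy: "(x, y) \<in> P" and xs: "x \<noteq> s" and k: "y - t = k * (x - s)"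
      have xs0: "x - s \<noteq> 0" using xs by simp
      have k': "(y - t) / (x - s) = k" using xs k by simp
      have "0 = ev2 (\<Sum>k\<in>{..r} <+> {..Suc r}. a k * v k (x, y)) s t" using a(2) xy by simp
      also have "\<dots> = (\<Sum>i\<le>r. ev2 (a (Inl i)) s t * ((y - t) ^ i * (x - s) ^ (r - i)))
        + (\<Sum>i\<le>Suc r. ev2 (a (Inr i)) s t * ((y - t) ^ i * (x - s) ^ (Suc r - i)))"
        unfolding sp by (simp add: v_def X_def Y_def del: sum.atMost_Suc)
      also have "\<dots> = (x - s) ^ r * ((x - s) * (\<Sum>i\<le>Suc r. ev2 (a (Inr i)) s t * k ^ i) + (\<Sum>i\<le>r. ev2 (a (Inl i)) s t * k ^ i))"
        unfolding sc[OF xs0] k' by (simp add: algebra_simps del: sum.atMost_Suc)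
      finally show "(x - s) * (\<Sum>i\<le>Suc r. ev2 (a (Inr i)) s t * k ^ i) + (\<Sum>i\<le>r. ev2 (a (Inl i)) s t * k ^ i) = 0"
        using xs by (simp del: sum.atMost_Suc)
    qed
    then show False
    proof (elim exE conjE)
      fix al be a' b' assume nz: "al \<noteq> 0 \<or> be \<noteq> 0"
        and t: "\<forall>(x, y)\<in>P. \<forall>k. ev2 al (y - k * x) k + x * ev2 be (y - k * x) k = 0"
        and A: "\<forall>s t k. ev2 al (t - k * s) k + s * ev2 be (t - k * s) k = (\<Sum>i\<le>r. ev2 (a' i) s t * k ^ i)"
        and B: "\<forall>s t k. ev2 be (t - k * s) k = (\<Sum>i\<le>Suc r. ev2 (b' i) s t * k ^ i)"
      have "al = 0 \<and> be = 0"
      proof (rule tangent_field_zero[where P = P and r = r and a = a' and b = b'])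
        show "ev2 al (y - k * x) k + x * ev2 be (y - k * x) k = 0" if "(x, y) \<in> P" for x y k
          using t that by fast
      qed (rule fin inj r col A[rule_format] B[rule_format])+
      with nz show False by simp
    qed
  next
    fix c assume c: "c \<noteq> 0" and ind: "\<forall>s t x. ev2 c s t \<noteq> 0 \<longrightarrow>
      (\<forall>p\<in>P. (\<Sum>k\<in>{..r} <+> {..Suc r}. x k * ev2 (v k p) s t) = 0) \<longrightarrow> (\<forall>k\<in>{..r} <+> {..Suc r}. x k = 0)"
    obtain s t A B where st: "ev2 c s t \<noteq> 0" and AB: "A \<noteq> 0 \<or> B \<noteq> 0" "degree A \<le> r" "degree B \<le> Suc r"
      and z: "\<And>x y. (x, y) \<in> P \<Longrightarrow> x \<noteq> s \<and> (x - s) * poly B ((y - t) / (x - s)) + poly A ((y - t) / (x - s)) = 0"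
      using gen[OF c] by blast
    define x where "x k = (case k of Inl i \<Rightarrow> coeff A i | Inr i \<Rightarrow> coeff B i)" for k
    have pA: "poly A k = (\<Sum>i\<le>r. coeff A i * k ^ i)" for k
      by (subst eq_lin_poly[OF AB(2)]) simp
    have pB: "poly B k = (\<Sum>i\<le>Suc r. coeff B i * k ^ i)" for k
      by (subst eq_lin_poly[OF AB(3)]) (simp del: sum.atMost_Suc)
    have "(\<Sum>k\<in>{..r} <+> {..Suc r}. x k * ev2 (v k p) s t) = 0" if "p \<in> P" for p
    proof -
      obtain x0 y0 where p: "p = (x0, y0)" by (cases p)
      have xs0: "x0 - s \<noteq> 0" using z that p by auto
      have "(\<Sum>k\<in>{..r} <+> {..Suc r}. x k * ev2 (v k p) s t) =
        (\<Sum>i\<le>r. coeff A i * ((y0 - t) ^ i * (x0 - s) ^ (r - i)))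
        + (\<Sum>i\<le>Suc r. coeff B i * ((y0 - t) ^ i * (x0 - s) ^ (Suc r - i)))"
        unfolding sp by (simp add: v_def X_def Y_def x_def p del: sum.atMost_Suc)
      also have "\<dots> = (x0 - s) ^ r * ((x0 - s) * poly B ((y0 - t) / (x0 - s)) + poly A ((y0 - t) / (x0 - s)))"
        unfolding sc[OF xs0] pA pB by (simp add: algebra_simps del: sum.atMost_Suc)
      also have "\<dots> = 0" using z[of x0 y0] that p by simp
      finally show ?thesis .
    qed
    then have x0: "\<forall>k\<in>{..r} <+> {..Suc r}. x k = 0" using ind st by blast
    have "coeff A i = 0" for i
      using x0 AB(2) by (cases "i \<le> r") (auto simp: x_def coeff_eq_0 InlI dest: bspec[of _ _ "Inl i"])
    moreover have "coeff B i = 0" for i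
      using x0 AB(3) by (cases "i \<le> Suc r") (auto simp: x_def coeff_eq_0 InrI dest: bspec[of _ _ "Inr i"])
    ultimately show False using AB(1) by (auto simp: poly_eq_iff)
  qed
qed

section \<open>Forms in three variables\<close>

abbreviation "lkp \<equiv> Poly_Mapping.lookup"

definition mono_at :: "complex^3 \<Rightarrow> (3 \<Rightarrow>\<^sub>0 nat) \<Rightarrow> complex" where
  "mono_at v \<alpha> = (\<Prod>i\<in>UNIV. (v $ i) ^ lkp \<alpha> i)"

lemma prod_UNIV_3: "prod f (UNIV :: 3 set) = f 1 * f 2 * f 3"
  unfolding UNIV_3 by (simp add: ac_simps)

lemma mono_at_3: "mono_at v \<alpha> = (v $ 1) ^ lkp \<alpha> 1 * (v $ 2) ^ lkp \<alpha> 2 * (v $ 3) ^ lkp \<alpha> 3"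
  by (simp add: mono_at_def prod_UNIV_3)

lemma mdeg_3: "mdeg \<alpha> = lkp \<alpha> 1 + lkp \<alpha> 2 + lkp \<alpha> 3"
  by (simp add: mdeg_def sum_3)

lemma peval_superset:
  assumes "finite S" "Poly_Mapping.keys F \<subseteq> S"
  shows "peval F v = (\<Sum>\<alpha>\<in>S. lkp F \<alpha> * mono_at v \<alpha>)"
  unfolding peval_def mono_at_def
  by (rule sum.mono_neutral_left) (use assms in \<open>auto simp: in_keys_iff\<close>)

lemma peval_add: "peval (F + G) v = peval F v + peval G v"
proof -
  let ?S = "Poly_Mapping.keys F \<union> Poly_Mapping.keys G"
  have "Poly_Mapping.keys (F + G) \<subseteq> ?S" by (rule keys_add)
  then show ?thesis
    by (subst (1 2 3) peval_superset[of ?S]) (auto simp: lookup_add algebra_simps sum.distrib)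
qed

lemma lookup_tscale: "lkp (tscale c F) \<alpha> = c * lkp F \<alpha>"
  by (simp add: tscale_def Poly_Mapping.map.rep_eq when_def)

lemma peval_tscale: "peval (tscale c F) v = c * peval F v"
proof -
  have "Poly_Mapping.keys (tscale c F) \<subseteq> Poly_Mapping.keys F"
    by (auto simp: in_keys_iff lookup_tscale)
  then show ?thesis
    by (subst (1 2) peval_superset[of "Poly_Mapping.keys F"])
      (auto simp: lookup_tscale sum_distrib_left mult.assoc)
qed

lemma peval_0 [simp]: "peval 0 v = 0"
  by (simp add: peval_def)

lemma peval_sum: "peval (sum f A) v = (\<Sum>x\<in>A. peval (f x) v)"
  by (induction A rule: infinite_finite_induct) (simp_all add: peval_add)

lemma peval_single: "peval (Poly_Mapping.single \<alpha> c) v = c * mono_at v \<alpha>"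
  by (subst peval_superset[of "{\<alpha>}"]) auto

lemma peval_pdiff: "peval (pdiff i F) v =
  (\<Sum>\<alpha>\<in>Poly_Mapping.keys F. lkp F \<alpha> * (of_nat (lkp \<alpha> i) * mono_at v (\<alpha> - Poly_Mapping.single i 1)))"
  unfolding pdiff_def by (simp add: peval_sum peval_single algebra_simps)

lemma lookup_diff_single:
  "lkp (\<alpha> - Poly_Mapping.single i 1) j = (if i = j then lkp \<alpha> i - 1 else lkp \<alpha> j)" for \<alpha> :: "3 \<Rightarrow>\<^sub>0 nat"
  by (simp add: lookup_minus lookup_single when_def)

lemmas lookup_diff = lookup_diff_single lookup_diff_single[unfolded One_nat_def]

lemma mono_at_diff:
  "of_nat (lkp \<alpha> i) * mono_at v (\<alpha> - Poly_Mapping.single i 1) =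
    of_nat (lkp \<alpha> i) * (v $ i) ^ (lkp \<alpha> i - 1) * (\<Prod>j\<in>UNIV - {i}. (v $ j) ^ lkp \<alpha> j)"
proof -
  have "mono_at v (\<alpha> - Poly_Mapping.single i 1) =
    (v $ i) ^ (lkp \<alpha> i - 1) * (\<Prod>j\<in>UNIV - {i}. (v $ j) ^ lkp (\<alpha> - Poly_Mapping.single i 1) j)"
    unfolding mono_at_def by (subst prod.remove[of _ i]) (simp_all add: lookup_diff)
  also have "(\<Prod>j\<in>UNIV - {i}. (v $ j) ^ lkp (\<alpha> - Poly_Mapping.single i 1) j) = (\<Prod>j\<in>UNIV - {i}. (v $ j) ^ lkp \<alpha> j)"
    by (rule prod.cong) (auto simp: lookup_diff)
  finally show ?thesis by simp
qed

lemma euler_mono: "v $ i * (of_nat (lkp \<alpha> i) * mono_at v (\<alpha> - Poly_Mapping.single i 1)) = of_nat (lkp \<alpha> i) * mono_at v \<alpha>"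
proof (cases "lkp \<alpha> i")
  case (Suc n)
  have "mono_at v \<alpha> = (v $ i) ^ (lkp \<alpha> i) * (\<Prod>j\<in>UNIV - {i}. (v $ j) ^ lkp \<alpha> j)"
    unfolding mono_at_def by (subst prod.remove[of _ i]) simp_all
  then show ?thesis unfolding mono_at_diff by (simp add: Suc algebra_simps)
qed simp

lemma euler:
  assumes "form d F"
  shows "(\<Sum>i\<in>UNIV. v $ i * peval (pdiff i F) v) = of_nat d * peval F v"
proof -
  have "(\<Sum>i\<in>UNIV. v $ i * peval (pdiff i F) v) =
    (\<Sum>i\<in>UNIV. \<Sum>\<alpha>\<in>Poly_Mapping.keys F. lkp F \<alpha> * (of_nat (lkp \<alpha> i) * mono_at v \<alpha>))"
    unfolding peval_pdiff sum_distrib_left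
    by (intro sum.cong refl) (subst mult.left_commute, simp only: euler_mono)
  also have "\<dots> = (\<Sum>\<alpha>\<in>Poly_Mapping.keys F. lkp F \<alpha> * (of_nat (mdeg \<alpha>) * mono_at v \<alpha>))"
    by (subst sum.swap) (simp add: mdeg_def sum_distrib_left sum_distrib_right)
  also have "\<dots> = (\<Sum>\<alpha>\<in>Poly_Mapping.keys F. of_nat d * (lkp F \<alpha> * mono_at v \<alpha>))"
    by (rule sum.cong) (use assms in \<open>auto simp: form_def\<close>)
  finally show ?thesis
    by (simp add: peval_superset[OF _ subset_refl] sum_distrib_left)
qed

lemma form_pdiff: assumes "form d F" shows "form (d - 1) (pdiff i F)"
  unfolding form_def
proof
  fix \<beta> assume "\<beta> \<in> Poly_Mapping.keys (pdiff i F)"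
  then have "\<beta> \<in> (\<Union>\<alpha>\<in>Poly_Mapping.keys F. Poly_Mapping.keys
     (Poly_Mapping.single (\<alpha> - Poly_Mapping.single i 1) (of_nat (lkp \<alpha> i) * lkp F \<alpha>)))"
    unfolding pdiff_def using keys_sum by fast
  then obtain \<alpha> where a: "\<alpha> \<in> Poly_Mapping.keys F" "\<beta> = \<alpha> - Poly_Mapping.single i 1" "lkp \<alpha> i \<noteq> 0"
    by (auto split: if_splits)
  have "mdeg \<beta> + 1 = mdeg \<alpha>"
    using a(3) exhaust_3[of i] unfolding a(2) mdeg_3 lookup_diff by auto
  then show "mdeg \<beta> = d - 1" using assms a(1) by (auto simp: form_def)
qed

lemma peval_DERIV:
  "((\<lambda>z. peval F (x + z *s q)) has_field_derivative
    (\<Sum>i\<in>UNIV. q $ i * peval (pdiff i F) (x + z *s q))) (at z)"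
proof -
  have m: "((\<lambda>z. mono_at (x + z *s q) \<alpha>) has_field_derivative
    (\<Sum>i\<in>UNIV. q $ i * (of_nat (lkp \<alpha> i) * mono_at (x + z *s q) (\<alpha> - Poly_Mapping.single i 1)))) (at z)" for \<alpha>
    unfolding mono_at_3 sum_3
    by (auto intro!: derivative_eq_intros simp: lookup_diff algebra_simps)
  have "((\<lambda>z. \<Sum>\<alpha>\<in>Poly_Mapping.keys F. lkp F \<alpha> * mono_at (x + z *s q) \<alpha>) has_field_derivative
    (\<Sum>\<alpha>\<in>Poly_Mapping.keys F. lkp F \<alpha> * (\<Sum>i\<in>UNIV. q $ i * (of_nat (lkp \<alpha> i) * mono_at (x + z *s q) (\<alpha> - Poly_Mapping.single i 1))))) (at z)"
    by (rule DERIV_sum) (rule DERIV_cmult[OF m])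
  also have "(\<Sum>\<alpha>\<in>Poly_Mapping.keys F. lkp F \<alpha> * (\<Sum>i\<in>UNIV. q $ i * (of_nat (lkp \<alpha> i) * mono_at (x + z *s q) (\<alpha> - Poly_Mapping.single i 1))))
    = (\<Sum>i\<in>UNIV. q $ i * peval (pdiff i F) (x + z *s q))"
    unfolding peval_pdiff sum_distrib_left
    by (subst sum.swap) (simp add: algebra_simps)
  finally show ?thesis by (simp add: peval_superset[OF _ subset_refl])
qed

section \<open>Restriction of forms to lines\<close>

lemma coeff_mult_top:
  fixes p q :: "complex poly"
  assumes "degree p \<le> m" "degree q \<le> n"
  shows "coeff (p * q) (m + n) = coeff p m * coeff q n"
proof -
  have "coeff (p * q) (m + n) = (\<Sum>i\<le>m + n. coeff p i * coeff q (m + n - i))" by (rule coeff_mult)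
  also have "\<dots> = (\<Sum>i\<in>{m}. coeff p i * coeff q (m + n - i))"
  proof (rule sum.mono_neutral_right)
    show "\<forall>i\<in>{..m + n} - {m}. coeff p i * coeff q (m + n - i) = 0"
    proof
      fix i assume "i \<in> {..m + n} - {m}"
      then show "coeff p i * coeff q (m + n - i) = 0"
        using assms by (cases "i < m") (auto simp: coeff_eq_0)
    qed
  qed auto
  finally show ?thesis by simp
qed

lemma linear_power:
  "degree ([:u, w:] ^ n) \<le> n" "coeff ([:u, w:] ^ n) n = w ^ n" for u w :: complex
proof -
  show d: "degree ([:u, w:] ^ n) \<le> n" for n
    by (rule order.trans[OF degree_power_le]) simp
  show "coeff ([:u, w:] ^ n) n = w ^ n"
  proof (induction n)
    case (Suc n)
    have "coeff ([:u, w:] * [:u, w:] ^ n) (1 + n) = coeff [:u, w:] 1 * coeff ([:u, w:] ^ n) n"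
      by (rule coeff_mult_top) (auto intro: d)
    then show ?case using Suc by simp
  qed simp
qed

text \<open>Each monomial restricts to a product of powers of linear polynomials. The coefficient of
  index \<open>d\<close> is the value at the direction \<open>w\<close>, the point at infinity of
  the line, which later lets top coefficients be compared.\<close>

lemma form_line:
  assumes "form d F"
  shows "\<exists>p. degree p \<le> d \<and> coeff p d = peval F w \<and> (\<forall>z. poly p z = peval F (u + z *s w))"
proof -
  define m where "m \<alpha> = [:u $ 1, w $ 1:] ^ lkp \<alpha> 1 * [:u $ 2, w $ 2:] ^ lkp \<alpha> 2 * [:u $ 3, w $ 3:] ^ lkp \<alpha> 3"
    for \<alpha> :: "3 \<Rightarrow>\<^sub>0 nat"
  have m: "degree (m \<alpha>) \<le> d" "coeff (m \<alpha>) d = mono_at w \<alpha>" if "\<alpha> \<in> Poly_Mapping.keys F" for \<alpha>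
  proof -
    have d: "d = lkp \<alpha> 1 + lkp \<alpha> 2 + lkp \<alpha> 3" using assms that by (auto simp: form_def mdeg_3)
    have d2: "degree ([:u $ 1, w $ 1:] ^ lkp \<alpha> 1 * [:u $ 2, w $ 2:] ^ lkp \<alpha> 2) \<le> lkp \<alpha> 1 + lkp \<alpha> 2"
      by (intro order.trans[OF degree_mult_le] add_mono linear_power)
    then show "degree (m \<alpha>) \<le> d"
      unfolding m_def d by (intro order.trans[OF degree_mult_le] add_mono linear_power d2)
    show "coeff (m \<alpha>) d = mono_at w \<alpha>"
      unfolding m_def d by (simp add: coeff_mult_top d2 linear_power mono_at_3)
  qed
  define p where "p = (\<Sum>\<alpha>\<in>Poly_Mapping.keys F. smult (lkp F \<alpha>) (m \<alpha>))"
  have "poly (m \<alpha>) z = mono_at (u + z *s w) \<alpha>" for z \<alpha> by (simp add: m_def mono_at_3 algebra_simps)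
  then have "poly p z = peval F (u + z *s w)" for z
    by (simp add: p_def poly_sum peval_superset[OF _ subset_refl])
  moreover have "degree p \<le> d"
    unfolding p_def by (rule degree_sum_le) (auto intro: order.trans[OF degree_smult_le] m)
  moreover have "coeff p d = peval F w"
    unfolding p_def by (simp add: coeff_sum m peval_superset[OF _ subset_refl])
  ultimately show ?thesis by blast
qed

lemma peval_scale: "form d F \<Longrightarrow> peval F (c *s v) = c ^ d * peval F v"
proof -
  assume "form d F"
  then have "lkp F \<alpha> * mono_at (c *s v) \<alpha> = c ^ d * (lkp F \<alpha> * mono_at v \<alpha>)"
    if "\<alpha> \<in> Poly_Mapping.keys F" for \<alpha>
  proof -
    have "d = lkp \<alpha> 1 + lkp \<alpha> 2 + lkp \<alpha> 3" using \<open>form d F\<close> that by (auto simp: form_def mdeg_3)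
    then show ?thesis by (simp add: mono_at_3 power_mult_distrib power_add)
  qed
  then show ?thesis
    unfolding peval_superset[OF finite_keys subset_refl] sum_distrib_left by (rule sum.cong[OF refl])
qed

text \<open>Vanishing to order \<open>m\<close> at \<open>q\<close> bounds the degree in \<open>z\<close> of \<open>F (x + z q)\<close> by \<open>d - m\<close>;
  the induction step compares coefficients in Euler's relation.\<close>

lemma vanishes_to_order_line:
  assumes "form d F" "m \<le> d" "vanishes_to_order m F p" "v \<in> coords p"
  shows "\<exists>P. degree P \<le> d - m \<and> (\<forall>z. poly P z = peval F (x + z *s v))"
  using assms(1-3)
proof (induction m arbitrary: d F)
  case 0
  then show ?case using form_line[of d F v x] by auto
next
  case (Suc m)
  have "vanishes_to_order m (pdiff i F) p" for i
    unfolding vanishes_to_order_def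
  proof (intro allI impI)
    fix il :: "3 list" assume "length il < m"
    then show "vanishes_at (fold pdiff il (pdiff i F)) p"
      using Suc.prems(3)[unfolded vanishes_to_order_def, rule_format, of "i # il"] by simp
  qed
  moreover have "form (d - 1) (pdiff i F)" for i by (rule form_pdiff[OF Suc.prems(1)])
  ultimately have "\<exists>P. degree P \<le> d - 1 - m \<and> (\<forall>z. poly P z = peval (pdiff i F) (x + z *s v))" for i
    using Suc.IH[of "d - 1" "pdiff i F"] Suc.prems(2) by auto
  then obtain Q where Q: "\<And>i. degree (Q i) \<le> d - 1 - m"
    "\<And>i z. poly (Q i) z = peval (pdiff i F) (x + z *s v)" by metis
  obtain P where P: "degree P \<le> d" "coeff P d = peval F v" "\<And>z. poly P z = peval F (x + z *s v)"
    using form_line[OF Suc.prems(1), of v x] by blast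
  have "(poly P has_field_derivative poly (pderiv P) z) (at z)" for z by (rule poly_DERIV)
  then have P': "poly (pderiv P) z = (\<Sum>i\<in>UNIV. v $ i * poly (Q i) z)" for z
    using peval_DERIV[of F x v z] DERIV_unique unfolding Q P(3)[symmetric, abs_def] by blast
  define R where "R = (\<Sum>i\<in>UNIV. smult (x $ i) (Q i))"
  have "smult (of_nat d) P = R + pCons 0 (pderiv P)"
  proof (subst poly_eq_poly_eq_iff[symmetric], rule ext)
    fix z
    have "of_nat d * poly P z = (\<Sum>i\<in>UNIV. (x + z *s v) $ i * peval (pdiff i F) (x + z *s v))"
      using euler[OF Suc.prems(1), of "x + z *s v"] P by simp
    then show "poly (smult (of_nat d) P) z = poly (R + pCons 0 (pderiv P)) z"
      by (simp add: R_def poly_sum P' Q sum_distrib_left algebra_simps sum.distrib)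
  qed
  moreover have "degree (Q i) \<le> d - Suc m" for i using Q(1)[of i] by simp
  then have "degree R \<le> d - Suc m"
    unfolding R_def by (intro degree_sum_le order.trans[OF degree_smult_le]) auto
  ultimately have c: "of_nat d * coeff P (Suc k) = of_nat (Suc k) * coeff P (Suc k)" if "Suc k > d - Suc m" for k
  proof -
    have "coeff R (Suc k) = 0" using \<open>degree R \<le> _\<close> that by (intro coeff_eq_0) auto
    with \<open>smult (of_nat d) P = _\<close> have "coeff (smult (of_nat d) P) (Suc k) = of_nat (Suc k) * coeff P (Suc k)"
      by (simp add: coeff_pderiv del: of_nat_Suc)
    then show ?thesis by simp
  qed
  \<comment> \<open>Euler's relation gives nothing at index \<open>d\<close>; that coefficient is
    the value of \<open>F\<close> at \<open>v\<close>, which vanishes because the order is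
    positive.\<close>
  have "vanishes_at F p" using Suc.prems(3)[unfolded vanishes_to_order_def, rule_format, of "[]"] by simp
  then have Pd: "coeff P d = 0" using assms(4) P by (simp add: vanishes_at_def)
  have "coeff P k = 0" if "k > d - Suc m" for k
  proof (cases "k = d")
    case False
    from that obtain k' where k': "k = Suc k'" by (cases k) auto
    from c[of k'] that have "(of_nat d - of_nat k :: complex) * coeff P k = 0"
      unfolding k' by (simp add: algebra_simps)
    then show ?thesis using False by simp
  qed (use Pd in simp)
  then have "degree P \<le> d - Suc m" by (intro degree_le) auto
  then show ?case using P by blast
qed

text \<open>Kronecker substitution: with \<open>N\<close> above all exponents, inserting
  \<open>z\<close>, \<open>z ^ N\<close> and \<open>z ^ (N * N)\<close> sends distinct monomials to
  distinct powers of \<open>z\<close>, since the digits in base \<open>N\<close> are unique.\<close>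

lemma peval_eq_0D:
  assumes "\<And>v. peval F v = 0"
  shows "F = 0"
proof (rule ccontr)
  assume "F \<noteq> 0"
  then obtain \<beta> where b: "\<beta> \<in> Poly_Mapping.keys F" by fastforce
  let ?K = "Poly_Mapping.keys F"
  define N where "N = Suc (\<Sum>\<alpha>\<in>?K. mdeg \<alpha>)"
  have "N > 0" by (simp add: N_def)
  have N: "lkp \<alpha> i < N" if "\<alpha> \<in> ?K" for \<alpha> i
  proof -
    have "lkp \<alpha> i \<le> mdeg \<alpha>" unfolding mdeg_def by (rule member_le_sum) auto
    also have "\<dots> \<le> (\<Sum>\<alpha>\<in>?K. mdeg \<alpha>)" using that by (intro member_le_sum) auto
    finally show ?thesis by (simp add: N_def)
  qed
  define e where "e \<alpha> = lkp \<alpha> 1 + N * (lkp \<alpha> 2 + N * lkp \<alpha> 3)" for \<alpha> :: "3 \<Rightarrow>\<^sub>0 nat"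
  have inj: "\<alpha> = \<beta>" if "\<alpha> \<in> ?K" "\<beta> \<in> ?K" "e \<alpha> = e \<beta>" for \<alpha> \<beta>
  proof -
    have 1: "lkp \<alpha> 1 = lkp \<beta> 1"
      using arg_cong[OF that(3), of "\<lambda>x. x mod N"] N that by (simp add: e_def)
    then have 2: "lkp \<alpha> 2 + N * lkp \<alpha> 3 = lkp \<beta> 2 + N * lkp \<beta> 3" using that(3) \<open>N > 0\<close> by (simp add: e_def)
    have 3: "lkp \<alpha> 2 = lkp \<beta> 2"
      using arg_cong[OF 2, of "\<lambda>x. x mod N"] N that by simp
    then have "lkp \<alpha> 3 = lkp \<beta> 3" using 2 \<open>N > 0\<close> by simp
    with 1 3 show ?thesis by (intro poly_mapping_eqI) (metis exhaust_3)
  qed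
  define p where "p = (\<Sum>\<alpha>\<in>?K. monom (lkp F \<alpha>) (e \<alpha>))"
  have "poly p z = peval F (vector [z, z ^ N, z ^ (N * N)])" for z
    unfolding p_def peval_superset[OF finite_keys subset_refl] poly_sum poly_monom
    by (rule sum.cong) (simp_all add: mono_at_3 e_def power_add power_mult algebra_simps)
  then have "p = 0" using assms by (subst poly_eq_poly_eq_iff[symmetric]) (simp add: fun_eq_iff)
  moreover have "coeff p (e \<beta>) = (\<Sum>\<alpha>\<in>?K. if \<alpha> = \<beta> then lkp F \<alpha> else 0)"
    unfolding p_def coeff_sum by (rule sum.cong) (use inj b in auto)
  ultimately show False using b by (simp add: in_keys_iff)
qed

section \<open>Homogeneous coordinates of points\<close>

lemma coords_iff:
  assumes "v \<in> coords p"
  shows "w \<in> coords p \<longleftrightarrow> w \<noteq> 0 \<and> (\<exists>c. w = c *s v)"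
proof -
  have "coords p \<in> (- {0 :: complex^3}) // proportional" using coords by blast
  then obtain u where u: "u \<noteq> 0" "coords p = proportional `` {u}" by (auto simp: quotient_def)
  from assms u obtain a where a: "v = a *s u" "v \<noteq> 0" by (auto simp: proportional_def)
  then have "a \<noteq> 0" by auto
  then have u': "u = inverse a *s v" using a by (simp add: vec_eq_iff)
  have "(\<exists>c. w = c *s u) \<longleftrightarrow> (\<exists>c. w = c *s v)"
  proof
    assume "\<exists>c. w = c *s u"
    then obtain c where "w = c *s u" ..
    then have "w = (c * inverse a) *s v" by (subst (asm) u') simp
    then show "\<exists>c. w = c *s v" ..
  next
    assume "\<exists>c. w = c *s v"
    then obtain c where "w = (c * a) *s u" unfolding a(1) by auto
    then show "\<exists>c. w = c *s u" ..
  qed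
  then show ?thesis unfolding u(2) using u(1) by (auto simp: proportional_def)
qed

lemma coords_nonempty: "\<exists>v. v \<in> coords p"
proof -
  have "coords p \<in> (- {0 :: complex^3}) // proportional" using coords by blast
  then show ?thesis by (auto simp: quotient_def proportional_def) (metis scale_one vector_smult_lid)
qed

lemma coords_nonzero: "v \<in> coords p \<Longrightarrow> v \<noteq> 0"
  using coords_iff by blast

lemma coords_exists:
  assumes "v \<noteq> 0"
  shows "\<exists>p. v \<in> coords p"
proof -
  have "proportional `` {v} \<in> (- {0 :: complex^3}) // proportional"
    using assms by (intro quotientI) auto
  then have "coords (Cp2 (proportional `` {v})) = proportional `` {v}" by (rule Cp2_inverse)
  moreover have "v \<in> proportional `` {v}" using assms by (auto simp: proportional_def) (metis vector_smult_lid)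
  ultimately show ?thesis by blast
qed

lemma coords_inject: "v \<in> coords p \<Longrightarrow> v \<in> coords q \<Longrightarrow> p = q"
  by (metis coords_iff coords_inject set_eqI)

lemma vanishes_at_iff: "form d F \<Longrightarrow> v \<in> coords p \<Longrightarrow> vanishes_at F p \<longleftrightarrow> peval F v = 0"
  unfolding vanishes_at_def using coords_iff peval_scale by (metis mult_zero_right)

section \<open>Linear functionals and dimension counts\<close>

definition lin :: "(tpoly \<Rightarrow> complex) \<Rightarrow> bool" where
  "lin f \<longleftrightarrow> (\<forall>F G. f (F + G) = f F + f G) \<and> (\<forall>c F. f (tscale c F) = c * f F)"

lemma lin_peval: "lin (\<lambda>F. peval F v)" "lin (\<lambda>F. peval F v - peval F w)"
  by (auto simp: lin_def peval_add peval_tscale algebra_simps)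

lemma lin_add: "lin f \<Longrightarrow> f (F + G) = f F + f G"
  and lin_scale: "lin f \<Longrightarrow> f (tscale c F) = c * f F"
  by (auto simp: lin_def)

lemma lin_0: "lin f \<Longrightarrow> f 0 = 0"
  unfolding lin_def by (metis add_cancel_right_left)

text \<open>A basis of the kernel and one vector outside it span \<open>V\<close>. The finite set
  \<open>T\<close> guarantees that this basis is finite, so that its cardinality measures the
  dimension.\<close>

lemma dim_kernel:
  assumes V: "tp.subspace V" "V \<subseteq> tp.span T" "finite T" and f: "lin f"
  shows "tdim V \<le> Suc (tdim {v \<in> V. f v = 0})"
proof -
  let ?K = "{v \<in> V. f v = 0}"
  obtain B where B: "B \<subseteq> ?K" "tp.independent B" "?K \<subseteq> tp.span B" "card B = tdim ?K"
    using tp.basis_exists[of ?K] by blast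
  have finB: "finite B"
    using tp.independent_span_bound[OF V(3) B(2)] B(1) V(2) by blast
  show ?thesis
  proof (cases "?K = V")
    case False
    then obtain w where w: "w \<in> V" "f w \<noteq> 0" by blast
    have "v \<in> tp.span (insert w B)" if "v \<in> V" for v
    proof -
      define c where "c = - (f v / f w)"
      have "v + tscale c w \<in> V" using that w V(1) by (intro tp.subspace_add tp.subspace_scale)
      moreover have "f (v + tscale c w) = 0" using w by (simp only: lin_add[OF f] lin_scale[OF f]) (simp add: c_def)
      ultimately have "v + tscale c w \<in> tp.span B" using B(3) by blast
      then have "v + tscale c w \<in> tp.span (insert w B)" using tp.span_mono[of B "insert w B"] by blast
      then have "v + tscale c w - tscale c w \<in> tp.span (insert w B)"
        by (rule tp.span_diff) (simp add: tp.span_scale tp.span_base)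
      then show ?thesis by simp
    qed
    then have "tdim V \<le> card (insert w B)" using finB by (intro tp.dim_le_card) auto
    also have "\<dots> \<le> Suc (card B)" by (rule card_insert_le_m1) auto
    finally show ?thesis using B(4) by simp
  qed simp
qed

lemma subspace_kernel: "tp.subspace V \<Longrightarrow> \<forall>f\<in>Fs. lin f \<Longrightarrow> tp.subspace {v \<in> V. \<forall>f\<in>Fs. f v = 0}"
  by (auto simp: tp.subspace_def lin_add lin_scale lin_0)

lemma dim_kernel_finite:
  assumes V: "tp.subspace V" "V \<subseteq> tp.span T" "finite T" and "finite Fs" "\<forall>f\<in>Fs. lin f"
  shows "tdim V \<le> tdim {v \<in> V. \<forall>f\<in>Fs. f v = 0} + card Fs"
  using assms(4,5)
proof (induction Fs rule: finite_induct)
  case (insert f Fs)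
  let ?K = "{v \<in> V. \<forall>f\<in>Fs. f v = 0}"
  have "tdim ?K \<le> Suc (tdim {v \<in> ?K. f v = 0})"
    using insert.prems V by (intro dim_kernel[of _ T] subspace_kernel) auto
  moreover have "{v \<in> ?K. f v = 0} = {v \<in> V. \<forall>f\<in>insert f Fs. f v = 0}" by auto
  ultimately show ?case using insert by simp
qed simp

lemma exists_nonzero:
  assumes V: "tp.subspace V" "V \<subseteq> tp.span T" "finite T" and "finite Fs" "\<forall>f\<in>Fs. lin f" "card Fs < tdim V"
  shows "\<exists>v\<in>V. v \<noteq> 0 \<and> (\<forall>f\<in>Fs. f v = 0)"
proof (rule ccontr)
  assume "\<not> ?thesis"
  then have "{v \<in> V. \<forall>f\<in>Fs. f v = 0} \<subseteq> tp.span {}" by auto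
  then have "tdim {v \<in> V. \<forall>f\<in>Fs. f v = 0} \<le> card ({} :: tpoly set)" by (rule tp.dim_le_card) simp
  then show False using dim_kernel_finite[OF assms(1-5)] assms(6) by simp
qed

section \<open>Dimensions of the spaces of forms\<close>

definition mono_basis :: "nat \<Rightarrow> tpoly set" where
  "mono_basis j = (\<lambda>\<alpha>. Poly_Mapping.single \<alpha> 1) ` {\<alpha>. mdeg \<alpha> = j}"

lemma finite_mdeg: "finite {\<alpha>. mdeg \<alpha> = j}"
proof -
  have "inj_on (\<lambda>\<alpha>. (lkp \<alpha> 1, lkp \<alpha> 2, lkp \<alpha> 3)) {\<alpha> :: 3 \<Rightarrow>\<^sub>0 nat. mdeg \<alpha> = j}"
    by (rule inj_onI) (auto intro!: poly_mapping_eqI, metis exhaust_3)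
  moreover have "(\<lambda>\<alpha>. (lkp \<alpha> 1, lkp \<alpha> 2, lkp \<alpha> 3)) ` {\<alpha> :: 3 \<Rightarrow>\<^sub>0 nat. mdeg \<alpha> = j} \<subseteq> {..j} \<times> {..j} \<times> {..j}"
    by (auto simp: mdeg_3)
  ultimately show ?thesis by (rule inj_on_finite) simp
qed

lemma finite_mono_basis: "finite (mono_basis j)"
  unfolding mono_basis_def by (intro finite_imageI finite_mdeg)

lemma subspace_forms: "tp.subspace {F. form j F}"
proof -
  have "form j (F + G)" if "form j F" "form j G" for F G
    using that keys_add[of F G] unfolding form_def by blast
  moreover have "form j (tscale c F)" if "form j F" for c F
    using that unfolding form_def by (auto simp: in_keys_iff lookup_tscale)
  moreover have "form j 0" by (simp add: form_def)
  ultimately show ?thesis by (intro tp.subspaceI) blast+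
qed

lemma poly_mapping_sum_tscale: "F = (\<Sum>\<alpha>\<in>Poly_Mapping.keys F. tscale (lkp F \<alpha>) (Poly_Mapping.single \<alpha> 1))" for F :: tpoly
proof (rule poly_mapping_eqI)
  fix \<beta>
  have "(\<Sum>\<alpha>\<in>Poly_Mapping.keys F. lkp (tscale (lkp F \<alpha>) (Poly_Mapping.single \<alpha> 1)) \<beta>)
    = (\<Sum>\<alpha>\<in>Poly_Mapping.keys F. if \<alpha> = \<beta> then lkp F \<alpha> else 0)"
    by (rule sum.cong) (auto simp: lookup_tscale lookup_single)
  also have "\<dots> = lkp F \<beta>" by (simp add: in_keys_iff)
  finally show "lkp F \<beta> = lkp (\<Sum>\<alpha>\<in>Poly_Mapping.keys F. tscale (lkp F \<alpha>) (Poly_Mapping.single \<alpha> 1)) \<beta>"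
    by (simp add: lookup_sum)
qed

lemma span_mono_basis: "{F. form j F} \<subseteq> tp.span (mono_basis j)"
proof
  fix F assume "F \<in> {F. form j F}"
  then have "Poly_Mapping.single \<alpha> 1 \<in> mono_basis j" if "\<alpha> \<in> Poly_Mapping.keys F" for \<alpha>
    using that by (auto simp: form_def mono_basis_def)
  then have "(\<Sum>\<alpha>\<in>Poly_Mapping.keys F. tscale (lkp F \<alpha>) (Poly_Mapping.single \<alpha> 1)) \<in> tp.span (mono_basis j)"
    by (intro tp.span_sum tp.span_scale tp.span_base)
  then show "F \<in> tp.span (mono_basis j)" by (simp flip: poly_mapping_sum_tscale)
qed

lemma independent_mono_basis: "tp.independent (mono_basis j)"
proof
  assume "tp.dependent (mono_basis j)"
  then obtain u w where w: "w \<in> mono_basis j" "u w \<noteq> 0" and s: "(\<Sum>v\<in>mono_basis j. tscale (u v) v) = 0"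
    using tp.dependent_finite[OF finite_mono_basis] by blast
  then obtain \<beta> where b: "w = Poly_Mapping.single \<beta> 1" by (auto simp: mono_basis_def)
  have "0 = lkp (\<Sum>v\<in>mono_basis j. tscale (u v) v) \<beta>" using s by simp
  also have "\<dots> = (\<Sum>v\<in>mono_basis j. if v = w then u v else 0)"
    unfolding lookup_sum lookup_tscale
    by (rule sum.cong) (auto simp: mono_basis_def b lookup_single when_def split: if_splits)
  also have "\<dots> = u w" using w(1) finite_mono_basis by simp
  finally show False using w(2) by simp
qed

text \<open>The exponent vectors \<open>(a, b, j - a - b)\<close> number
  \<open>(j + 2) choose 2\<close>, split here so that \<open>j choose 2\<close> cancels against the
  expected conditions of the multiple point.\<close>

lemma card_mono_basis: "2 * j + 1 + (j choose 2) \<le> card (mono_basis j)"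
proof -
  define e :: "nat \<times> nat \<Rightarrow> tpoly" where "e = (\<lambda>(a, b). Poly_Mapping.single
    (Poly_Mapping.single 1 a + Poly_Mapping.single 2 b + Poly_Mapping.single 3 (j - a - b)) 1)"
  let ?S = "SIGMA a:{..j}. {..j - a}"
  have e3: "(1::3) \<noteq> 2" "(1::3) \<noteq> 3" "(2::3) \<noteq> 3" by simp_all
  have "inj_on e ?S"
  proof (rule inj_onI)
    fix p q assume "e p = e q"
    then have "Poly_Mapping.single 1 (fst p) + Poly_Mapping.single 2 (snd p) + Poly_Mapping.single 3 (j - fst p - snd p)
      = Poly_Mapping.single (1::3) (fst q) + Poly_Mapping.single 2 (snd q) + Poly_Mapping.single 3 (j - fst q - snd q)"
      (is "?L = ?R") unfolding e_def case_prod_beta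
      by (metis lookup_single_eq lookup_single_not_eq zero_neq_one)
    then have "lkp ?L 1 = lkp ?R 1" "lkp ?L 2 = lkp ?R 2" by simp_all
    then show "p = q" by (simp add: lookup_add lookup_single prod_eq_iff)
  qed
  moreover have "e ` ?S \<subseteq> mono_basis j"
  proof safe
    fix a b assume ab: "a \<le> j" "b \<le> j - a"
    show "e (a, b) \<in> mono_basis j" unfolding e_def mono_basis_def case_prod_conv
      by (rule imageI) (use ab in \<open>simp add: mdeg_3 lookup_add lookup_single\<close>)
  qed
  ultimately have "card ?S \<le> card (mono_basis j)"
    using finite_mono_basis card_inj_on_le by blast
  moreover have "card ?S = (\<Sum>a\<le>j. Suc (j - a))" by (simp add: card_SigmaI)
  moreover have "(\<Sum>a\<le>j. Suc (j - a)) = (\<Sum>a\<le>j. Suc a)"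
    by (rule sum.reindex_bij_witness[of _ "\<lambda>a. j - a" "\<lambda>a. j - a"]) auto
  moreover have "(\<Sum>a\<le>j. Suc a) = 2 * j + 1 + (j choose 2)"
    by (induction j) (auto simp: numeral_2_eq_2)
  ultimately show ?thesis by simp
qed

lemma dim_forms: "2 * j + 1 + (j choose 2) \<le> tdim {F. form j F}"
proof -
  have "mono_basis j \<subseteq> {F. form j F}" by (auto simp: mono_basis_def form_def)
  then have "tdim {F. form j F} = card (mono_basis j)"
    by (rule tp.dim_unique[OF _ span_mono_basis independent_mono_basis refl])
  then show ?thesis using card_mono_basis by simp
qed

lemma subspace_forms_through: "tp.subspace (forms_through j Z)"
  using subspace_forms[of j]
  by (auto simp: forms_through_def tp.subspace_def vanishes_at_def peval_add peval_tscale)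

text \<open>For a form, vanishing at a point is one linear condition, tested on a single
  representative.\<close>

lemma dim_forms_through:
  assumes "finite Z"
  shows "2 * j + 1 + (j choose 2) \<le> tdim (forms_through j Z) + card Z"
proof -
  define rep where "rep p = (SOME v. v \<in> coords p)" for p
  have rep: "rep p \<in> coords p" for p unfolding rep_def using coords_nonempty by (rule someI_ex)
  let ?Fs = "(\<lambda>p F. peval F (rep p)) ` Z"
  have "tdim {F. form j F} \<le> tdim {F \<in> {F. form j F}. \<forall>f\<in>?Fs. f F = 0} + card ?Fs"
    by (rule dim_kernel_finite[OF subspace_forms span_mono_basis finite_mono_basis])
      (use assms lin_peval in auto)
  moreover have "{F \<in> {F. form j F}. \<forall>f\<in>?Fs. f F = 0} = forms_through j Z"
    by (auto simp: forms_through_def vanishes_at_iff[OF _ rep])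
  moreover have "card ?Fs \<le> card Z" by (rule card_image_le[OF assms])
  ultimately show ?thesis using dim_forms[of j] by simp
qed

section \<open>Affine charts adapted to a finite set of points\<close>

lemma pdiff_superset:
  assumes "finite S" "Poly_Mapping.keys F \<subseteq> S"
  shows "pdiff i F = (\<Sum>\<alpha>\<in>S. Poly_Mapping.single (\<alpha> - Poly_Mapping.single i 1) (of_nat (lkp \<alpha> i) * lkp F \<alpha>))"
  unfolding pdiff_def
  by (rule sum.mono_neutral_left) (use assms in \<open>auto simp: in_keys_iff\<close>)

lemma pdiff_add: "pdiff i (F + G) = pdiff i F + pdiff i G"
proof -
  let ?S = "Poly_Mapping.keys F \<union> Poly_Mapping.keys G"
  have "Poly_Mapping.keys (F + G) \<subseteq> ?S" by (rule keys_add)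
  then show ?thesis
    by (subst (1 2 3) pdiff_superset[of ?S])
      (auto simp: lookup_add ring_distribs sum.distrib single_add)
qed

lemma tscale_single: "tscale c (Poly_Mapping.single \<alpha> x) = Poly_Mapping.single \<alpha> (c * x)"
  by (rule poly_mapping_eqI) (simp add: lookup_tscale lookup_single when_def)

lemma pdiff_tscale: "pdiff i (tscale c F) = tscale c (pdiff i F)"
proof -
  have "Poly_Mapping.keys (tscale c F) \<subseteq> Poly_Mapping.keys F"
    by (auto simp: in_keys_iff lookup_tscale)
  then show ?thesis
    by (subst (1 2) pdiff_superset[of "Poly_Mapping.keys F"])
      (auto simp: lookup_tscale tp.scale_sum_right tscale_single ac_simps)
qed

lemma fold_pdiff:
  "fold pdiff il (F + G) = fold pdiff il F + fold pdiff il G"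
  "fold pdiff il (tscale c F) = tscale c (fold pdiff il F)"
  by (induction il arbitrary: F G) (simp_all add: pdiff_add pdiff_tscale)

lemma fold_pdiff_0: "fold pdiff il 0 = 0"
  using fold_pdiff(2)[of il 0 0] by simp

lemma subspace_forms_through_mult: "tp.subspace (forms_through_mult j Z m q)"
  using subspace_forms_through[of j Z]
  unfolding forms_through_mult_def tp.subspace_def vanishes_to_order_def vanishes_at_def
  by (auto simp: fold_pdiff fold_pdiff_0 peval_add peval_tscale)

lemma forms_through_mult_span: "forms_through_mult j Z m q \<subseteq> tp.span (mono_basis j)"
  using span_mono_basis[of j] by (auto simp: forms_through_mult_def forms_through_def)

text \<open>A projective coordinate system whose line at infinity \<open>z = 0\<close> misses
  \<open>Z\<close> and whose vertical lines, those through the point of \<open>e2\<close>, contain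
  at most one point of \<open>Z\<close>. The assumption \<open>dual\<close> carries equations of
  lines back to the standard coordinates.\<close>

locale chart =
  fixes Z :: "cp2 set" and e1 e2 e3 :: "complex^3" and xc yc :: "cp2 \<Rightarrow> complex"
    and E :: "complex \<Rightarrow> complex \<Rightarrow> complex \<Rightarrow> complex^3"
  defines "E X Y z \<equiv> X *s e1 + Y *s e2 + z *s e3"
  assumes fin: "finite Z"
    and rep: "p \<in> Z \<Longrightarrow> E (xc p) (yc p) 1 \<in> coords p"
    and inj: "inj_on xc Z"
    and span: "\<exists>X Y z. v = E X Y z"
    and dual: "\<exists>a. \<forall>X Y z. (\<Sum>i\<in>UNIV. a $ i * E X Y z $ i) = m0 * z + m1 * X + m2 * Y"

lemma chart_exists:
  assumes "finite Z"
  shows "\<exists>e1 e2 e3 xc yc. chart Z e1 e2 e3 xc yc"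
proof -
  define rp where "rp p = (SOME v. v \<in> coords p)" for p
  have rp: "rp p \<in> coords p" for p unfolding rp_def using coords_nonempty by (rule someI_ex)
  have rp0: "rp p \<noteq> 0" for p using rp coords_nonzero by blast
  have "finite (\<Union>p\<in>Z. {c. poly [:rp p $ 1, rp p $ 2, rp p $ 3:] c = 0})"
  proof (intro finite_UN_I assms poly_roots_finite)
    fix p show "[:rp p $ 1, rp p $ 2, rp p $ 3:] \<noteq> 0"
      using rp0[of p] by (auto simp: vec_eq_iff forall_3)
  qed
  then obtain c where c: "c \<notin> (\<Union>p\<in>Z. {c. poly [:rp p $ 1, rp p $ 2, rp p $ 3:] c = 0})"
    using ex_new_if_finite[OF infinite_UNIV_char_0] by blast
  \<comment> \<open>The coefficients lie on the moment curve, so each point of \<open>Z\<close>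
    excludes only finitely many \<open>c\<close>.\<close>
  define zf where "zf p = rp p $ 1 + c * rp p $ 2 + c\<^sup>2 * rp p $ 3" for p
  have zf: "zf p \<noteq> 0" if "p \<in> Z" for p
    using c that by (auto simp: zf_def algebra_simps power2_eq_square)
  \<comment> \<open>As a polynomial in \<open>b\<close> it vanishes where the first affine
    coordinates of \<open>p\<close> and \<open>q\<close> agree.\<close>
  define bad where "bad p q = [:rp p $ 2 * zf q - rp q $ 2 * zf p, rp p $ 3 * zf q - rp q $ 3 * zf p:]" for p q
  have bad: "bad p q \<noteq> 0" if "p \<in> Z" "q \<in> Z" "p \<noteq> q" for p q
  proof
    assume "bad p q = 0"
    then have 23: "rp p $ 2 * zf q = rp q $ 2 * zf p" "rp p $ 3 * zf q = rp q $ 3 * zf p"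
      by (auto simp: bad_def)
    have "rp p $ 1 * zf q = zf p * zf q - c * (rp p $ 2 * zf q) - c\<^sup>2 * (rp p $ 3 * zf q)"
      by (simp add: zf_def[of p] algebra_simps)
    also have "\<dots> = rp q $ 1 * zf p" unfolding 23 by (simp add: zf_def[of q] algebra_simps)
    finally have "\<forall>i. rp p $ i * zf q = rp q $ i * zf p" using 23 by (simp add: forall_3)
    then have "rp p = (zf p / zf q) *s rp q" using zf that by (simp add: vec_eq_iff field_simps)
    then have "rp p \<in> coords q" using rp0 coords_iff[OF rp[of q]] by blast
    then show False using coords_inject[OF rp] that by blast
  qed
  have "finite (\<Union>p\<in>Z. \<Union>q\<in>Z - {p}. {b. poly (bad p q) b = 0})"
    using assms bad by (intro finite_UN_I poly_roots_finite) auto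
  then obtain b where b: "b \<notin> (\<Union>p\<in>Z. \<Union>q\<in>Z - {p}. {b. poly (bad p q) b = 0})"
    using ex_new_if_finite[OF infinite_UNIV_char_0] by blast
  \<comment> \<open>This is the basis dual to the forms \<open>v $ 2 + b * v $ 3\<close>,
    \<open>v $ 3\<close> and \<open>v $ 1 + c * v $ 2 + c ^ 2 * v $ 3\<close>, which serve as the
    coordinates \<open>X\<close>, \<open>Y\<close> and \<open>z\<close>.\<close>
  define e1 e2 e3 :: "complex^3" where "e1 = vector [- c, 1, 0]" "e2 = vector [c * b - c\<^sup>2, - b, 1]" "e3 = vector [1, 0, 0]"
  define xc yc where "xc p = (rp p $ 2 + b * rp p $ 3) / zf p" and "yc p = rp p $ 3 / zf p" for p
  have "chart Z e1 e2 e3 xc yc"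
  proof
    show "finite Z" by fact
    show "xc p *s e1 + yc p *s e2 + 1 *s e3 \<in> coords p" if "p \<in> Z" for p
    proof -
      have "xc p *s e1 + yc p *s e2 + 1 *s e3 = inverse (zf p) *s rp p"
      proof -
        have "rp p = (rp p $ 2 + b * rp p $ 3) *s e1 + rp p $ 3 *s e2 + zf p *s e3"
          by (simp add: vec_eq_iff forall_3 e1_e2_e3_def zf_def algebra_simps power2_eq_square)
        then have "inverse (zf p) *s rp p = inverse (zf p) *s ((rp p $ 2 + b * rp p $ 3) *s e1 + rp p $ 3 *s e2 + zf p *s e3)"
          by simp
        also have "\<dots> = (inverse (zf p) * (rp p $ 2 + b * rp p $ 3)) *s e1 + (inverse (zf p) * rp p $ 3) *s e2
            + (inverse (zf p) * zf p) *s e3"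
          unfolding vector_add_ldistrib vector_smult_assoc ..
        finally show ?thesis using zf[OF that] by (simp add: xc_def yc_def divide_inverse mult.commute)
      qed
      moreover have "inverse (zf p) *s rp p \<noteq> 0" using zf[OF that] rp0 by simp
      ultimately show ?thesis using coords_iff[OF rp[of p]] by metis
    qed
    show "inj_on xc Z"
    proof (rule inj_onI, rule ccontr)
      fix p q assume pq: "p \<in> Z" "q \<in> Z" "xc p = xc q" "p \<noteq> q"
      then have "poly (bad p q) b = 0"
        using zf[of p] zf[of q] by (simp add: bad_def xc_def frac_eq_eq algebra_simps)
      then show False using b pq by auto
    qed
    show "\<exists>X Y z. v = X *s e1 + Y *s e2 + z *s e3" for v
      by (intro exI[of _ "v $ 2 + b * v $ 3"] exI[of _ "v $ 3"] exI[of _ "v $ 1 + c * v $ 2 + c\<^sup>2 * v $ 3"])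
        (simp add: vec_eq_iff forall_3 e1_e2_e3_def algebra_simps)
    show "\<exists>a. \<forall>X Y z. (\<Sum>i\<in>UNIV. a $ i * (X *s e1 + Y *s e2 + z *s e3) $ i) = m0 * z + m1 * X + m2 * Y" for m0 m1 m2
      by (intro exI[of _ "vector [m0, m0 * c + m1, m0 * c\<^sup>2 + m1 * b + m2] :: complex^3"])
        (simp add: sum_3 e1_e2_e3_def algebra_simps power2_eq_square)
  qed
  then show ?thesis by blast
qed

context chart
begin

lemma E_nonzero: "E X Y 1 \<noteq> 0"
proof
  assume "E X Y 1 = 0"
  moreover obtain a where "\<And>X Y z. (\<Sum>i\<in>UNIV. a $ i * E X Y z $ i) = 1 * z + 0 * X + 0 * Y" using dual by blast
  then have "(\<Sum>i\<in>UNIV. a $ i * E X Y 1 $ i) = 1" by simp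
  ultimately show False by simp
qed

definition pts :: "(complex \<times> complex) set" where "pts = (\<lambda>p. (xc p, yc p)) ` Z"

lemma finite_pts: "finite pts" and inj_pts: "inj_on fst pts" and card_pts: "card pts = card Z"
proof -
  show "finite pts" using fin by (simp add: pts_def)
  show "inj_on fst pts" using inj by (auto simp: pts_def inj_on_def)
  have "inj_on (\<lambda>p. (xc p, yc p)) Z" using inj by (auto simp: inj_on_def)
  then show "card pts = card Z" by (simp add: pts_def card_image)
qed

text \<open>Some form defining the complement of \<open>U\<close> is nonzero, and it remains nonzero
  on the affine chart; its product with \<open>h\<close> is a nonzero polynomial in
  \<open>(s, t)\<close>.\<close>

lemma generic_point:
  assumes U: "zariski_open U" "U \<noteq> {}" and h: "h \<noteq> 0"
  shows "\<exists>s t q. ev2 h s t \<noteq> 0 \<and> q \<in> U \<and> E s t 1 \<in> coords q"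
proof -
  obtain S where S: "\<forall>F\<in>S. \<exists>d. form d F" "- U = {p. \<forall>F\<in>S. vanishes_at F p}"
    using U(1) by (auto simp: zariski_open_def)
  obtain q0 where "q0 \<in> U" using U(2) by blast
  then obtain F where F: "F \<in> S" "\<not> vanishes_at F q0" using S(2) by blast
  then obtain d where d: "form d F" using S(1) by blast
  obtain v where v: "peval F v \<noteq> 0" using F(2) by (auto simp: vanishes_at_def)
  have "polyfun3 (\<lambda>u s t. \<Sum>\<alpha>\<in>Poly_Mapping.keys F. lkp F \<alpha> *
    ((s * e1 $ 1 + t * e2 $ 1 + e3 $ 1) ^ lkp \<alpha> 1 * (s * e1 $ 2 + t * e2 $ 2 + e3 $ 2) ^ lkp \<alpha> 2
      * (s * e1 $ 3 + t * e2 $ 3 + e3 $ 3) ^ lkp \<alpha> 3))"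
    by (intro polyfun3_intros)
  then have "polyfun3 (\<lambda>u s t. peval F (E s t 1))"
    by (simp add: peval_superset[OF finite_keys subset_refl] mono_at_3 E_def)
  then obtain Q where Q: "\<And>u s t. peval F (E s t 1) = ev3 Q u s t" unfolding polyfun3_def by blast
  define g where "g = poly Q [:[:0:]:]"
  have g: "ev2 g s t = peval F (E s t 1)" for s t using Q[of s t 0] by (simp add: g_def ev3_def)
  have "g \<noteq> 0"
  proof
    assume "g = 0"
    then have z1: "peval F (E s t 1) = 0" for s t using g[of s t] by simp
    have zn: "peval F (E X Y z) = 0" if "z \<noteq> 0" for X Y z
    proof -
      have "E X Y z = z *s E (X / z) (Y / z) 1" using that by (simp add: E_def vec_eq_iff field_simps)
      then show ?thesis by (simp add: peval_scale[OF d] z1)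
    qed
    obtain X Y z where vE: "v = E X Y z" using span by blast
    \<comment> \<open>Points at infinity are reached along \<open>e3\<close>: a polynomial in
      \<open>z\<close> that vanishes for all \<open>z \<noteq> 0\<close> is zero.\<close>
    obtain p where p: "\<And>z. poly p z = peval F (E X Y 0 + z *s e3)" using form_line[OF d] by blast
    have "E X Y 0 + z *s e3 = E X Y z" for z by (simp add: E_def)
    then have "poly p z = peval F (E X Y z)" for z by (simp add: p)
    then have "poly p z = 0" if "z \<noteq> 0" for z using zn[OF that] by simp
    then have "UNIV - {0} \<subseteq> {z. poly p z = 0}" by auto
    then have "p = 0" using poly_roots_finite[of p] finite_subset infinite_UNIV_char_0
      by (metis finite_Diff2 finite.emptyI finite_insert)
    then have "peval F v = 0" using vE \<open>\<And>z. poly p z = peval F (E X Y z)\<close>[of z] by simp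
    then show False using v by simp
  qed
  then obtain s t where st: "ev2 (g * h) s t \<noteq> 0" using ev2_nonzero[of "g * h"] h by auto
  obtain q where q: "E s t 1 \<in> coords q" using coords_exists[OF E_nonzero] by blast
  have "q \<in> U"
  proof (rule ccontr)
    assume "q \<notin> U"
    then have "vanishes_at F q" using S(2) F(1) by blast
    then show False using st q g by (auto simp: vanishes_at_def)
  qed
  then show ?thesis using st q by auto
qed

text \<open>Through \<open>q = (s, t)\<close> a form with multiplicity \<open>j - 1\<close> is \<open>B + z A\<close>, where \<open>A\<close> and \<open>B\<close>
  are binary forms in the slope \<open>\<kappa>\<close> of the lines through \<open>q\<close>.\<close>

lemma section_pair:
  assumes j: "j \<ge> 1" and F: "F \<in> forms_through_mult j Z (j - 1) q" and q: "E s t 1 \<in> coords q"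
  shows "\<exists>A B. degree A \<le> j - 1 \<and> degree B \<le> j \<and>
    (\<forall>k. poly A k = peval F (e1 + k *s e2 + E s t 1) - peval F (e1 + k *s e2)) \<and>
    (\<forall>k. poly B k = peval F (e1 + k *s e2)) \<and>
    (\<forall>(x, y)\<in>pts. x \<noteq> s \<longrightarrow> (x - s) * poly B ((y - t) / (x - s)) + poly A ((y - t) / (x - s)) = 0) \<and>
    (A = 0 \<and> B = 0 \<longrightarrow> F = 0)"
proof -
  let ?q = "E s t 1"
  have f: "form j F" "\<And>p. p \<in> Z \<Longrightarrow> vanishes_at F p" "vanishes_to_order (j - 1) F q"
    using F by (auto simp: forms_through_mult_def forms_through_def)
  \<comment> \<open>Vanishing to order \<open>j - 1\<close> leaves degree at most 1 in the direction
    of \<open>q\<close>.\<close>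
  have aff: "peval F (x + z *s ?q) = peval F x + z * (peval F (x + ?q) - peval F x)" for x z
  proof -
    obtain P where P: "degree P \<le> j - (j - 1)" "\<And>z. poly P z = peval F (x + z *s ?q)"
      using vanishes_to_order_line[OF f(1) _ f(3) q, of x] by auto
    then have "degree P \<le> 1" using j by simp
    then have "poly P z = coeff P 0 + coeff P 1 * z" for z
      by (subst eq_lin_poly[of P 1]) simp_all
    then have e: "peval F (x + z *s ?q) = coeff P 0 + coeff P 1 * z" for z using P(2) by simp
    have "coeff P 0 = peval F x" using e[of 0] by simp
    moreover from this have "coeff P 1 = peval F (x + ?q) - peval F x" using e[of 1] by simp
    ultimately show ?thesis unfolding e by (simp only: mult.commute)
  qed
  obtain B where B: "degree B \<le> j" "coeff B j = peval F e2" "\<And>k. poly B k = peval F (e1 + k *s e2)"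
    using form_line[OF f(1)] by blast
  obtain C where C: "degree C \<le> j" "coeff C j = peval F e2" "\<And>k. poly C k = peval F (e1 + ?q + k *s e2)"
    using form_line[OF f(1)] by blast
  define A where "A = C - B"
  have A: "poly A k = peval F (e1 + k *s e2 + ?q) - peval F (e1 + k *s e2)" for k
    using B(3) C(3) by (simp add: A_def ac_simps)
  \<comment> \<open>\<open>B\<close> and \<open>C\<close> share the coefficient of index
    \<open>j\<close>, the value of \<open>F\<close> at \<open>e2\<close>, so it cancels in
    \<open>A\<close>.\<close>
  have "coeff A i = 0" if "i > j - 1" for i
    using that B(1,2) C(1,2) by (cases "i = j") (auto simp: A_def coeff_eq_0)
  then have dA: "degree A \<le> j - 1" by (intro degree_le) auto
  have gen: "peval F (X *s e1 + Y *s e2 + z *s ?q) = X ^ j * (poly B (Y / X) + z / X * poly A (Y / X))"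
    if "X \<noteq> 0" for X Y z
  proof -
    have "X *s e1 + Y *s e2 + z *s ?q = X *s (e1 + (Y / X) *s e2 + (z / X) *s ?q)"
      using that by (simp add: vec_eq_iff field_simps)
    then show ?thesis by (simp only: peval_scale[OF f(1)] aff A B)
  qed
  have "(x - s) * poly B ((y - t) / (x - s)) + poly A ((y - t) / (x - s)) = 0"
    if xy: "(x, y) \<in> pts" "x \<noteq> s" for x y
  proof -
    obtain p where p: "p \<in> Z" "x = xc p" "y = yc p" using xy by (auto simp: pts_def)
    have "E x y 1 = (x - s) *s e1 + (y - t) *s e2 + 1 *s ?q" by (simp add: E_def vec_eq_iff algebra_simps)
    moreover have "peval F (E x y 1) = 0" using f(2)[OF p(1)] rep[OF p(1)] p by (simp add: vanishes_at_def)
    ultimately have "(x - s) ^ j * (poly B ((y - t) / (x - s)) + 1 / (x - s) * poly A ((y - t) / (x - s))) = 0"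
      using gen[of "x - s" "y - t" 1] xy(2) by simp
    then have "poly B ((y - t) / (x - s)) + 1 / (x - s) * poly A ((y - t) / (x - s)) = 0" using xy(2) by simp
    then have "(x - s) * (poly B ((y - t) / (x - s)) + 1 / (x - s) * poly A ((y - t) / (x - s))) = 0" by simp
    then show ?thesis using xy(2) by (simp add: distrib_left)
  qed
  moreover have "F = 0" if AB: "A = 0" "B = 0"
  proof (rule peval_eq_0D)
    fix v
    obtain X Y z where "v = E X Y z" using span by blast
    then have v: "v = (X - z * s) *s e1 + (Y - z * t) *s e2 + z *s ?q"
      by (simp add: E_def vec_eq_iff algebra_simps)
    \<comment> \<open>The formula \<open>gen\<close> excludes one value of the coordinate along
      \<open>e1\<close>; moving \<open>v\<close> in that direction gives a polynomial with
      infinitely many roots.\<close>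
    obtain p where p: "\<And>k. poly p k = peval F (v + k *s e1)" using form_line[OF f(1)] by blast
    have p0: "poly p k = 0" if "k \<noteq> - (X - z * s)" for k
    proof -
      have e: "v + k *s e1 = (X - z * s + k) *s e1 + (Y - z * t) *s e2 + z *s ?q"
        unfolding v by (simp add: vec_eq_iff algebra_simps)
      have ne: "X - z * s + k \<noteq> 0" using that by (metis add.commute add_eq_0_iff)
      show ?thesis unfolding p e gen[OF ne] by (simp add: AB)
    qed
    then have "UNIV - {- (X - z * s)} \<subseteq> {k. poly p k = 0}" by auto
    then have "p = 0" using poly_roots_finite[of p] finite_subset infinite_UNIV_char_0
      by (metis finite_Diff2 finite.emptyI finite_insert)
    then show "peval F v = 0" using p[of 0] by simp
  qed
  ultimately show ?thesis using dA A B(1,3) by blast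
qed

text \<open>The values of \<open>A\<close> and \<open>B\<close> at prescribed slopes are linear
  functionals of the form, and fewer functionals than the dimension have a common nonzero kernel
  vector.\<close>

lemma killed_pair:
  assumes j: "j \<ge> 1" and q: "E s t 1 \<in> coords q" and s: "\<forall>(x, y)\<in>pts. x \<noteq> s"
    and K: "finite KA" "finite KB" "card KA + card KB < tdim (forms_through_mult j Z (j - 1) q)"
  shows "\<exists>A B. degree A \<le> j - 1 \<and> degree B \<le> j \<and> (A \<noteq> 0 \<or> B \<noteq> 0) \<and>
    (\<forall>(x, y)\<in>pts. (x - s) * poly B ((y - t) / (x - s)) + poly A ((y - t) / (x - s)) = 0) \<and>
    (\<forall>k\<in>KA. poly A k = 0) \<and> (\<forall>k\<in>KB. poly B k = 0)"
proof -
  let ?fA = "\<lambda>k F. peval F (e1 + k *s e2 + E s t 1) - peval F (e1 + k *s e2)"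
  let ?fB = "\<lambda>k F. peval F (e1 + k *s e2)"
  define Fs where "Fs = ?fA ` KA \<union> ?fB ` KB"
  have "card Fs \<le> card KA + card KB"
    unfolding Fs_def by (rule order.trans[OF card_Un_le]) (intro add_mono card_image_le K)
  then have "card Fs < tdim (forms_through_mult j Z (j - 1) q)" using K(3) by linarith
  moreover have "finite Fs" "\<forall>f\<in>Fs. lin f" using K(1,2) lin_peval by (auto simp: Fs_def)
  ultimately obtain F where F: "F \<in> forms_through_mult j Z (j - 1) q" "F \<noteq> 0" "\<forall>f\<in>Fs. f F = 0"
    using exists_nonzero[OF subspace_forms_through_mult forms_through_mult_span finite_mono_basis] by metis
  from section_pair[OF j F(1) q] obtain A B where dA: "degree A \<le> j - 1" and dB: "degree B \<le> j"
    and A: "\<And>k. poly A k = ?fA k F" and B: "\<And>k. poly B k = ?fB k F"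
    and c: "\<forall>(x, y)\<in>pts. x \<noteq> s \<longrightarrow> (x - s) * poly B ((y - t) / (x - s)) + poly A ((y - t) / (x - s)) = 0"
    and nz: "A = 0 \<and> B = 0 \<longrightarrow> F = 0" by blast
  have "\<forall>k\<in>KA. poly A k = 0" unfolding A using F(3) by (auto simp only: Fs_def)
  moreover have "\<forall>k\<in>KB. poly B k = 0" unfolding B using F(3) by (auto simp only: Fs_def)
  moreover have "\<forall>(x, y)\<in>pts. (x - s) * poly B ((y - t) / (x - s)) + poly A ((y - t) / (x - s)) = 0"
    using c s by fast
  moreover have "A \<noteq> 0 \<or> B \<noteq> 0" using nz F(2) by blast
  ultimately show ?thesis using dA dB by blast
qed

end

section \<open>Sections of low degree\<close>

lemma prod_linear_dvd:
  fixes p :: "complex poly"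
  assumes "finite K" "\<forall>c\<in>K. poly p c = 0"
  shows "(\<Prod>c\<in>K. [:- c, 1:]) dvd p"
  using assms
proof (induction K arbitrary: p rule: finite_induct)
  case (insert c K)
  then obtain p' where p': "p = [:- c, 1:] * p'" by (metis insertI1 poly_eq_0_iff_dvd dvdE)
  have "poly p' d = 0" if "d \<in> K" for d
  proof -
    have "d \<noteq> c" "poly p d = 0" using insert that by auto
    then show ?thesis by (simp add: p')
  qed
  then have "(\<Prod>c\<in>K. [:- c, 1:]) dvd p'" using insert.IH by blast
  then show ?case using insert.hyps by (simp add: p' mult_dvd_mono del: mult_pCons_left)
qed simp

text \<open>A common root is the slope of a line through \<open>q\<close> contained in the curve.
  Removing it lowers the degree and the multiplicity by one.\<close>

lemma divide_pair:
  fixes A B :: "complex poly"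
  assumes K: "finite K" "\<forall>c\<in>K. poly A c = 0 \<and> poly B c = 0" "card K \<le> n"
    and "degree A \<le> n" "degree B \<le> Suc n"
  shows "\<exists>M A' B'. A = M * A' \<and> B = M * B' \<and> degree A' \<le> n - card K \<and> degree B' \<le> Suc (n - card K) \<and>
    (\<forall>k. k \<notin> K \<longrightarrow> poly M k \<noteq> 0)"
proof -
  define M where "M = (\<Prod>c\<in>K. [:- c, 1:])"
  obtain A' B' where AB: "A = M * A'" "B = M * B'"
    using prod_linear_dvd[OF K(1), of A] prod_linear_dvd[OF K(1), of B] K(2) unfolding M_def dvd_def by blast
  have M0: "M \<noteq> 0" using K(1) by (simp add: M_def)
  have dM: "degree M = card K" unfolding M_def by (subst degree_prod_eq_sum_degree) simp_all
  have "degree A' \<le> n - card K"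
    using assms(4) M0 K(3) unfolding AB(1) by (cases "A' = 0") (auto simp: degree_mult_eq dM)
  moreover have "degree B' \<le> Suc (n - card K)"
    using assms(5) M0 K(3) unfolding AB(2) by (cases "B' = 0") (auto simp: degree_mult_eq dM)
  moreover have "poly M k \<noteq> 0" if "k \<notin> K" for k using that K(1) by (auto simp: M_def poly_prod)
  ultimately show ?thesis using AB by blast
qed

lemma fresh_points:
  assumes "finite (S :: complex set)"
  shows "\<exists>K. finite K \<and> card K = n \<and> K \<inter> S = {}"
proof -
  have "infinite (- S)" using assms infinite_UNIV_char_0 by (simp add: Compl_eq_Diff_UNIV)
  then obtain K where "finite K" "card K = n" "K \<subseteq> - S" using infinite_arbitrarily_large by blast
  then show ?thesis by blast
qed

context chart
begin

abbreviation incident :: "complex \<Rightarrow> complex \<Rightarrow> complex poly \<Rightarrow> complex poly \<Rightarrow> bool" where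
  "incident s t A B \<equiv> \<forall>(x, y)\<in>pts. (x - s) * poly B ((y - t) / (x - s)) + poly A ((y - t) / (x - s)) = 0"

definition slopes :: "complex \<Rightarrow> complex \<Rightarrow> complex set" where
  "slopes s t = (\<lambda>(x, y). (y - t) / (x - s)) ` pts"

lemma incident_divide:
  assumes "incident s t (M * A) (M * B)" "\<And>k. k \<in> slopes s t \<Longrightarrow> poly M k \<noteq> 0"
  shows "incident s t A B"
proof safe
  fix x y assume xy: "(x, y) \<in> pts"
  let ?k = "(y - t) / (x - s)"
  have "poly M ?k * ((x - s) * poly B ?k + poly A ?k) = 0"
    using assms(1) xy by (auto simp: algebra_simps)
  moreover have "?k \<in> slopes s t" using xy by (force simp: slopes_def)
  ultimately show "(x - s) * poly B ?k + poly A ?k = 0" using assms(2) by simp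
qed

text \<open>At the slope of a point \<open>(x, y)\<close> both pairs are multiples of
  \<open>(s - x, 1)\<close>.\<close>

lemma incident_det:
  assumes "incident s t A B" "incident s t A' B'" "k \<in> slopes s t"
  shows "poly (A * B' - A' * B) k = 0"
proof -
  obtain x y where xy: "(x, y) \<in> pts" "k = (y - t) / (x - s)" using assms(3) by (auto simp: slopes_def)
  have "(x - s) * poly B k + poly A k = 0" "(x - s) * poly B' k + poly A' k = 0"
    using assms(1,2) xy by fast+
  then have "poly A k = - ((x - s) * poly B k)" "poly A' k = - ((x - s) * poly B' k)"
    by (simp_all only: eq_neg_iff_add_eq_0 add.commute)
  then show ?thesis by simp
qed

text \<open>If \<open>Z\<close> is small compared with \<open>j\<close>, the surplus dimension is
  spent on sections containing lines through \<open>q\<close> that miss \<open>Z\<close>. Splitting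
  these lines off brings the degree down to \<open>2 * r + 3 \<le> card Z\<close>.\<close>

lemma low_degree_section:
  assumes j: "j \<ge> 2" and q: "E s t 1 \<in> coords q"
    and s: "\<forall>(x, y)\<in>pts. x \<noteq> s" and sl: "inj_on (\<lambda>(x, y). (y - t) / (x - s)) pts"
    and N: "1 \<le> tdim (forms_through_mult j Z (j - 1) q)"
      "2 * j + 2 \<le> tdim (forms_through_mult j Z (j - 1) q) + card Z"
    and d: "j + 2 \<le> card Z"
  defines "r \<equiv> if 2 * j + 1 \<le> card Z then j - 1 else (card Z - 3) div 2"
  shows "\<exists>A B. (A \<noteq> 0 \<or> B \<noteq> 0) \<and> degree A \<le> r \<and> degree B \<le> Suc r \<and> incident s t A B"
proof -
  let ?N = "tdim (forms_through_mult j Z (j - 1) q)"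
  have j1: "j \<ge> 1" "j = Suc (j - 1)" using j by auto
  have fin_sl: "finite (slopes s t)" using finite_pts by (simp add: slopes_def)
  have card_sl: "card (slopes s t) = card Z" using card_image[OF sl] card_pts by (simp add: slopes_def)
  show ?thesis
  proof (cases "2 * j + 1 \<le> card Z")
    case True
    then show ?thesis using killed_pair[OF j1(1) q s, of "{}" "{}"] N j1 by (auto simp: r_def)
  next
    case False
    \<comment> \<open>The dimension is at least \<open>2 * k + 1\<close> for odd and
      \<open>2 * k + 2\<close> for even \<open>card Z\<close>, so both \<open>A\<close> and
      \<open>B\<close> can be made to vanish at \<open>k\<close> slopes.\<close>
    define k where "k = j - card Z div 2"
    have k: "card Z div 2 + k = j" "Suc k \<le> j - 1" using False d j by (auto simp: k_def)
    obtain K where K: "finite K" "card K = k" "K \<inter> slopes s t = {}" using fresh_points[OF fin_sl] by blast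
    have "card K + card K < ?N" using N(2) k K(2) by linarith
    from killed_pair[OF j1(1) q s K(1) K(1) this] obtain A1 B1 where
      1: "degree A1 \<le> j - 1" "degree B1 \<le> j" "A1 \<noteq> 0 \<or> B1 \<noteq> 0" "incident s t A1 B1"
        "\<forall>c\<in>K. poly A1 c = 0 \<and> poly B1 c = 0" by blast
    obtain M1 A1' B1' where M1: "A1 = M1 * A1'" "B1 = M1 * B1'" "degree A1' \<le> j - 1 - k"
      "degree B1' \<le> Suc (j - 1 - k)" "\<forall>k. k \<notin> K \<longrightarrow> poly M1 k \<noteq> 0"
      using divide_pair[OF K(1) 1(5), of "j - 1"] 1 K(2) k(2) j1 by auto
    have i1: "incident s t A1' B1'"
      by (rule incident_divide[where s = s and t = t and M = M1]) (use 1(4) M1(1,2,5) K(3) in auto)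
    show ?thesis
    proof (cases "even (card Z)")
      case odd: False
      then have "j - 1 - k = r" using False k(1) d by (auto simp: r_def elim!: oddE)
      then show ?thesis using M1 i1 1(3) by (intro exI[of _ A1'] exI[of _ B1']) auto
    next
      case even: True
      then have "2 * (card Z div 2) = card Z" by simp
      \<comment> \<open>One spare condition remains in the even case. It is imposed on one
        component, at a slope \<open>c\<close> where that component of the first pair is
        nonzero.\<close>
      define S where "S = K \<union> slopes s t \<union> {k. poly (if A1 \<noteq> 0 then A1 else B1) k = 0}"
      have "finite S" unfolding S_def using K(1) fin_sl 1(3) by (auto intro!: poly_roots_finite)
      then obtain c where c: "c \<notin> S" using ex_new_if_finite[OF infinite_UNIV_char_0] by blast
      define KA where "KA = (if A1 \<noteq> 0 then insert c K else K)"
      define KB where "KB = (if A1 \<noteq> 0 then K else insert c K)"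
      have fK: "finite KA" "finite KB" using K(1) by (auto simp: KA_def KB_def)
      have "c \<notin> K" using c by (simp add: S_def)
      then have "card KA + card KB = 2 * k + 1" using K by (auto simp: KA_def KB_def)
      then have "card KA + card KB < ?N" using N(2) k(1) \<open>2 * (card Z div 2) = card Z\<close> by linarith
      from killed_pair[OF j1(1) q s fK this] obtain A2 B2 where
        2: "degree A2 \<le> j - 1" "degree B2 \<le> j" "A2 \<noteq> 0 \<or> B2 \<noteq> 0" "incident s t A2 B2"
          "\<forall>c\<in>KA. poly A2 c = 0" "\<forall>c\<in>KB. poly B2 c = 0" by blast
      have 25: "\<forall>c\<in>K. poly A2 c = 0 \<and> poly B2 c = 0" using 2(5,6) by (auto simp: KA_def KB_def split: if_splits)
      obtain M2 A2' B2' where M2: "A2 = M2 * A2'" "B2 = M2 * B2'" "degree A2' \<le> j - 1 - k"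
        "degree B2' \<le> Suc (j - 1 - k)" "\<forall>k. k \<notin> K \<longrightarrow> poly M2 k \<noteq> 0"
        using divide_pair[OF K(1) 25, of "j - 1"] 2 K(2) k(2) j1 by auto
      have i2: "incident s t A2' B2'"
        by (rule incident_divide[where s = s and t = t and M = M2]) (use 2(4) M2(1,2,5) K(3) in auto)
      have dd: "2 * (j - 1 - k) + 1 < card Z" using k \<open>2 * (card Z div 2) = card Z\<close> by linarith
      \<comment> \<open>The determinant has degree at most \<open>card Z - 1\<close> but vanishes at
        all \<open>card Z\<close> slopes, so the two pairs are proportional.\<close>
      have "A1' * B2' - A2' * B1' = 0"
      proof (rule poly_eq_0_if_roots[OF _ fin_sl])
        show "degree (A1' * B2' - A2' * B1') \<le> 2 * (j - 1 - k) + 1"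
          using M1 M2 by (intro degree_diff_le; intro order.trans[OF degree_mult_le]) auto
        show "2 * (j - 1 - k) + 1 < card (slopes s t)" using dd card_sl by simp
      qed (rule incident_det[OF i1 i2])
      then have "M1 * M2 * (A1' * B2' - A2' * B1') = 0" by simp
      then have "A1 * B2 = A2 * B1" by (simp add: M1(1,2) M2(1,2) algebra_simps)
      then have pr: "poly A1 c * poly B2 c = poly A2 c * poly B1 c" by (metis poly_mult)
      \<comment> \<open>By proportionality the other component of the second pair vanishes at
        \<open>c\<close> too, so one more line splits off.\<close>
      have "poly A2 c = 0 \<and> poly B2 c = 0"
      proof (cases "A1 = 0")
        case True
        then have "poly B1 c \<noteq> 0" "poly B2 c = 0" using c 2(6) by (auto simp: S_def KB_def)
        then show ?thesis using pr by simp
      next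
        case False
        then have "poly A1 c \<noteq> 0" "poly A2 c = 0" using c 2(5) by (auto simp: S_def KA_def)
        then show ?thesis using pr by simp
      qed
      then have 26: "\<forall>c\<in>insert c K. poly A2 c = 0 \<and> poly B2 c = 0" using 25 by simp
      have cK: "card (insert c K) = Suc k" using K \<open>c \<notin> K\<close> by simp
      obtain M A B where M: "A2 = M * A" "B2 = M * B" "degree A \<le> j - 1 - Suc k"
        "degree B \<le> Suc (j - 1 - Suc k)" "\<forall>k. k \<notin> insert c K \<longrightarrow> poly M k \<noteq> 0"
        using divide_pair[OF _ 26, of "j - 1"] 2(1,2) cK K(1) k(2) j1 by auto
      have "incident s t A B"
        by (rule incident_divide[where s = s and t = t and M = M]) (use 2(4) M(1,2,5) K(3) c in \<open>auto simp: S_def\<close>)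
      moreover have "j - 1 - Suc k = r" using False k(1) d even by (auto simp: r_def elim!: evenE)
      ultimately show ?thesis using M 2(3) by (intro exI[of _ A] exI[of _ B]) auto
    qed
  qed
qed

text \<open>At most \<open>j + 1\<close> points are excluded by counting roots directly. Otherwise
  sections with \<open>2 * r + 3 \<le> card Z\<close> exist at generic points: \<open>r = 0\<close>
  would put four points on a line, and \<open>r \<ge> 1\<close> contradicts
  \<open>no_generic_section\<close>.\<close>

lemma no_unexpected:
  assumes col: "\<And>k m. card {p \<in> Z. yc p = k * xc p + m} \<le> 3"
  shows "\<not> admits_unexpected Z j"
proof
  assume "admits_unexpected Z j"
  then obtain U where j: "j \<ge> 2" and U: "zariski_open U" "U \<noteq> {}"
    and un: "\<And>q. q \<in> U \<Longrightarrow> int (tdim (forms_through_mult j Z (j - 1) q))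
               > max 0 (int (tdim (forms_through j Z)) - int (j choose 2))"
    by (auto simp: admits_unexpected_def)
  have N: "1 \<le> tdim (forms_through_mult j Z (j - 1) q)"
      "2 * j + 2 \<le> tdim (forms_through_mult j Z (j - 1) q) + card Z" if "q \<in> U" for q
    using un[OF that] dim_forms_through[OF fin, of j] by linarith+
  obtain h where h: "h \<noteq> 0" "\<And>s t. ev2 h s t \<noteq> 0 \<Longrightarrow> (\<forall>(x, y)\<in>pts. x \<noteq> s) \<and>
      inj_on (\<lambda>(x, y). (y - t) / (x - s)) pts"
    using generic_slopes[OF finite_pts inj_pts] by blast
  have col': "card {(x, y) \<in> pts. y = k * x + m} \<le> 3" for k m
  proof -
    have "{(x, y) \<in> pts. y = k * x + m} = (\<lambda>p. (xc p, yc p)) ` {p \<in> Z. yc p = k * xc p + m}"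
      by (auto simp: pts_def)
    also have "card \<dots> \<le> card {p \<in> Z. yc p = k * xc p + m}" using fin by (intro card_image_le) auto
    finally show ?thesis using col[of k m] by linarith
  qed
  show False
  proof (cases "card Z \<le> j + 1")
    case True
    obtain s t q where st: "ev2 h s t \<noteq> 0" "q \<in> U" "E s t 1 \<in> coords q"
      using generic_point[OF U h(1)] by blast
    from h(2)[OF st(1)] have s: "\<forall>(x, y)\<in>pts. x \<noteq> s" and sl: "inj_on (\<lambda>(x, y). (y - t) / (x - s)) pts"
      by auto
    have fin_sl: "finite (slopes s t)" using finite_pts by (simp add: slopes_def)
    have card_sl: "card (slopes s t) = card Z" using card_image[OF sl] card_pts by (simp add: slopes_def)
    \<comment> \<open>The \<open>j\<close> slopes force \<open>A = 0\<close>; then \<open>B\<close>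
      vanishes at the \<open>card Z\<close> slopes of the points and at
      \<open>j + 1 - card Z\<close> further ones.\<close>
    obtain KA :: "complex set" where KA: "finite KA" "card KA = j" using fresh_points[of "{}" j] by blast
    obtain KB where KB: "finite KB" "card KB = j + 1 - card Z" "KB \<inter> slopes s t = {}"
      using fresh_points[OF fin_sl] by blast
    have "card KA + card KB < tdim (forms_through_mult j Z (j - 1) q)"
      using N(2)[OF st(2)] KA KB True by linarith
    from killed_pair[OF _ st(3) s KA(1) KB(1) this] j obtain A B where
      AB: "degree A \<le> j - 1" "degree B \<le> j" "A \<noteq> 0 \<or> B \<noteq> 0" "incident s t A B"
        "\<forall>c\<in>KA. poly A c = 0" "\<forall>c\<in>KB. poly B c = 0" by auto
    have "A = 0" using KA AB j by (intro poly_eq_0_if_roots[of A "j - 1" KA]) auto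
    have "B = 0"
    proof (rule poly_eq_0_if_roots[of B j "KB \<union> slopes s t"])
      show "j < card (KB \<union> slopes s t)" using KB fin_sl card_sl True by (simp add: card_Un_disjoint)
      fix k assume "k \<in> KB \<union> slopes s t"
      then show "poly B k = 0"
      proof
        assume "k \<in> slopes s t"
        then obtain x y where xy: "(x, y) \<in> pts" "k = (y - t) / (x - s)" by (auto simp: slopes_def)
        then have "(x - s) * poly B k = 0" using AB(4) \<open>A = 0\<close> by auto
        then show "poly B k = 0" using s xy(1) by auto
      qed (use AB in auto)
    qed (use AB KB fin_sl in auto)
    with \<open>A = 0\<close> AB(3) show False by simp
  next
    case False
    define r where "r = (if 2 * j + 1 \<le> card Z then j - 1 else (card Z - 3) div 2)"
    have sec: "\<exists>A B. (A \<noteq> 0 \<or> B \<noteq> 0) \<and> degree A \<le> r \<and> degree B \<le> Suc r \<and> incident s t A B"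
      if "ev2 h s t \<noteq> 0" "q \<in> U" "E s t 1 \<in> coords q" for s t q
      unfolding r_def
      by (rule low_degree_section[OF j that(3)]) (use h(2)[OF that(1)] N[OF that(2)] False in auto)
    show False
    proof (cases "r = 0")
      case True
      then have c4: "card Z = 4" using False j by (auto simp: r_def split: if_splits)
      obtain s t q where st: "ev2 h s t \<noteq> 0" "q \<in> U" "E s t 1 \<in> coords q"
        using generic_point[OF U h(1)] by blast
      obtain A B where AB: "A \<noteq> 0 \<or> B \<noteq> 0" "degree A \<le> 0" "degree B \<le> 1" "incident s t A B"
        using sec[OF st] True by auto
      define a b0 b1 where "a = coeff A 0" "b0 = coeff B 0" "b1 = coeff B 1"
      have pA: "poly A k = a" and pB: "poly B k = b0 + b1 * k" for k
        by (subst eq_lin_poly[OF AB(2)], simp add: a_b0_b1_def, subst eq_lin_poly[OF AB(3)], simp add: a_b0_b1_def)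
      \<comment> \<open>With \<open>A\<close> constant and \<open>B\<close> linear, the section is
        the equation of a line containing all four points.\<close>
      have lin: "a + b0 * (x - s) + b1 * (y - t) = 0" if xy: "(x, y) \<in> pts" for x y
      proof -
        have "(x - s) * (b0 + b1 * ((y - t) / (x - s))) + a = 0" using AB(4) xy unfolding pA pB by auto
        moreover have "x - s \<noteq> 0" using h(2)[OF st(1)] xy by auto
        then have "(x - s) * (b0 + b1 * ((y - t) / (x - s))) = b0 * (x - s) + b1 * (y - t)"
          by (simp add: distrib_left)
        ultimately show ?thesis by (simp add: ac_simps)
      qed
      show False
      proof (cases "b1 = 0")
        case False
        have "y = (- b0 / b1) * x + (t + (b0 * s - a) / b1)" if "(x, y) \<in> pts" for x y
          using lin[OF that] False by (simp add: field_simps)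
        then have "{(x, y) \<in> pts. y = (- b0 / b1) * x + (t + (b0 * s - a) / b1)} = pts" by auto
        then show False using col'[of "- b0 / b1" "t + (b0 * s - a) / b1"] c4 card_pts by simp
      next
        \<comment> \<open>A vertical line cannot contain two of the points, since their first
          coordinates are distinct.\<close>
        case True
        have "b0 \<noteq> 0"
        proof
          assume "b0 = 0"
          obtain x y where "(x, y) \<in> pts" using c4 card_pts by (cases "pts = {}") auto
          then have "a = 0" using lin \<open>b0 = 0\<close> True by auto
          then have "A = 0" "B = 0" using pA pB True \<open>b0 = 0\<close>
            by (simp_all add: poly_eq_poly_eq_iff[symmetric] fun_eq_iff)
          then show False using AB(1) by simp
        qed
        then have "fst p = s - a / b0" if "p \<in> pts" for p
          using lin[of "fst p" "snd p"] that True by (simp add: field_simps)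
        then have "fst ` pts \<subseteq> {s - a / b0}" by auto
        then have "card (fst ` pts) \<le> 1" by (metis card.empty card_insert_disjoint card_mono finite.emptyI finite_insert insert_absorb insert_not_empty One_nat_def)
        then show False using card_image[OF inj_pts] c4 card_pts by simp
      qed
    next
      case r1: False
      have r3: "2 * r + 3 \<le> card pts" using False j unfolding card_pts r_def by auto
      show False
      proof (rule no_generic_section[OF finite_pts inj_pts _ r3 col'])
        show "1 \<le> r" using r1 by simp
        fix c :: "complex poly poly" assume "c \<noteq> 0"
        then have "h * c \<noteq> 0" using h(1) by simp
        from generic_point[OF U this] obtain s t q where
          st: "ev2 (h * c) s t \<noteq> 0" "q \<in> U" "E s t 1 \<in> coords q" by blast
        then have h0: "ev2 h s t \<noteq> 0" by simp
        from sec[OF h0 st(2,3)] obtain A B where "A \<noteq> 0 \<or> B \<noteq> 0" "degree A \<le> r" "degree B \<le> Suc r" "incident s t A B"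
          by blast
        moreover have "\<forall>(x, y)\<in>pts. x \<noteq> s" using h(2)[OF h0] by blast
        ultimately show "\<exists>s t A B. ev2 c s t \<noteq> 0 \<and> (A \<noteq> 0 \<or> B \<noteq> 0) \<and> degree A \<le> r \<and>
          degree B \<le> Suc r \<and> (\<forall>(x, y)\<in>pts. x \<noteq> s \<and>
            (x - s) * poly B ((y - t) / (x - s)) + poly A ((y - t) / (x - s)) = 0)"
          using st(1) by (intro exI[of _ s] exI[of _ t] exI[of _ A] exI[of _ B]) auto
      qed
    qed
  qed
qed

text \<open>Four collinear points of \<open>Z\<close> split the line off every cubic through \<open>Z\<close>, so only four points
  of the line impose conditions on cubics.\<close>

lemma no_unexpected_cubic:
  assumes four: "4 \<le> card {p \<in> Z. yc p = k * xc p + m}"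
  shows "\<not> admits_unexpected Z 3"
proof
  assume "admits_unexpected Z 3"
  then obtain U where U: "zariski_open U" "U \<noteq> {}"
    and un: "\<And>q. q \<in> U \<Longrightarrow> int (tdim (forms_through_mult 3 Z 2 q))
               > max 0 (int (tdim (forms_through 3 Z)) - int (3 choose 2))"
    by (auto simp: admits_unexpected_def)
  define L where "L = {p \<in> Z. yc p = k * xc p + m}"
  define D where "D = Z - L"
  obtain T where T: "T \<subseteq> L" "card T = 4"
    by (rule obtain_subset_with_card_n[OF four]) (simp only: L_def)
  have finL: "finite L" using fin by (simp add: L_def)
  have finT: "finite T" "finite D" using finite_subset[OF T(1) finL] fin by (simp_all add: D_def)
  have "forms_through 3 (T \<union> D) \<subseteq> forms_through 3 Z"
  proof
    fix F assume F: "F \<in> forms_through 3 (T \<union> D)"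
    then have f: "form 3 F" by (simp add: forms_through_def)
    obtain P where P: "degree P \<le> 3" "\<And>x. poly P x = peval F (E 0 m 1 + x *s E 1 k 0)"
      using form_line[OF f] by blast
    have eP: "peval F (E (xc p) (yc p) 1) = poly P (xc p)" if "p \<in> L" for p
    proof -
      have "E (xc p) (yc p) 1 = E 0 m 1 + xc p *s E 1 k 0"
        using that by (simp add: L_def E_def vec_eq_iff algebra_simps)
      then show ?thesis by (simp add: P(2))
    qed
    have "poly P x = 0" if x: "x \<in> xc ` T" for x
    proof -
      obtain p where p: "p \<in> T" "x = xc p" using x by blast
      then have "vanishes_at F p" using F by (simp add: forms_through_def)
      then show ?thesis using eP[of p] p T(1) rep[of p] by (auto simp: vanishes_at_def L_def)
    qed
    moreover have "T \<subseteq> Z" using T(1) by (auto simp: L_def)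
    then have "card (xc ` T) = 4" using T(2) by (simp add: card_image inj_on_subset[OF inj])
    ultimately have "P = 0" using P(1) finT by (intro poly_eq_0_if_roots[of P 3 "xc ` T"]) auto
    have "vanishes_at F p" if p: "p \<in> Z" for p
    proof (cases "p \<in> L")
      case True
      then show ?thesis using eP[OF True] \<open>P = 0\<close> vanishes_at_iff[OF f rep[OF p]] by simp
    qed (use F p in \<open>auto simp: forms_through_def D_def\<close>)
    then show "F \<in> forms_through 3 Z" using f by (simp add: forms_through_def)
  qed
  moreover have "forms_through 3 Z \<subseteq> forms_through 3 (T \<union> D)" using T by (auto simp: forms_through_def L_def D_def)
  ultimately have same: "forms_through 3 Z = forms_through 3 (T \<union> D)" by blast
  have "card (T \<union> D) \<le> 4 + card D" using card_Un_le[of T D] T(2) by simp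
  moreover have ch: "(3::nat) choose 2 = 3" by (simp add: numeral_2_eq_2 numeral_3_eq_3)
  moreover have "finite (T \<union> D)" using finT by simp
  ultimately have "10 \<le> tdim (forms_through 3 Z) + (4 + card D)"
    using dim_forms_through[of "T \<union> D" 3] unfolding same by linarith
  \<comment> \<open>The cubics through \<open>Z\<close> have dimension at least
    \<open>10 - 4 - card D\<close>; the double point is expected to cost 3, and the strict
    inequality gives one back.\<close>
  then have N: "1 \<le> tdim (forms_through_mult 3 Z 2 q)" "4 \<le> tdim (forms_through_mult 3 Z 2 q) + card D"
    if "q \<in> U" for q
    using un[OF that] unfolding ch by linarith+
  obtain h where h: "h \<noteq> 0" "\<And>s t. ev2 h s t \<noteq> 0 \<Longrightarrow> (\<forall>(x, y)\<in>pts. x \<noteq> s) \<and>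
      inj_on (\<lambda>(x, y). (y - t) / (x - s)) pts"
    using generic_slopes[OF finite_pts inj_pts] by blast
  \<comment> \<open>\<open>g\<close> vanishes exactly on the line \<open>y = k * x + m\<close>, so
    \<open>q\<close> is chosen off it.\<close>
  define g :: "complex poly poly" where "g = [:[:m, - 1:], [:k:]:]"
  have "g \<noteq> 0" by (simp add: g_def)
  then have "h * g \<noteq> 0" using h(1) by simp
  from generic_point[OF U this] obtain s t q where
    st: "ev2 (h * g) s t \<noteq> 0" "q \<in> U" "E s t 1 \<in> coords q" by blast
  define e where "e = m + k * s - t"
  have "ev2 g s t \<noteq> 0" using st(1) by simp
  then have e0: "e \<noteq> 0" by (auto simp: g_def e_def algebra_simps)
  from st(1) have h0: "ev2 h s t \<noteq> 0" by simp
  define sl where "sl p = (yc p - t) / (xc p - s)" for p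
  have xs: "xc p \<noteq> s" if "p \<in> Z" for p using h(2)[OF h0] that by (auto simp: pts_def)
  have inj_sl: "inj_on sl Z"
  proof (rule inj_onI)
    fix p p' assume pp: "p \<in> Z" "p' \<in> Z" "sl p = sl p'"
    then have "(xc p, yc p) = (xc p', yc p')"
      using inj_onD[of "\<lambda>(x, y). (y - t) / (x - s)" pts "(xc p, yc p)" "(xc p', yc p')"] h(2)[OF h0]
      by (auto simp: sl_def pts_def)
    then show "p = p'" using inj pp by (auto simp: inj_on_def)
  qed
  \<comment> \<open>The subtraction is truncated: if \<open>D\<close> has at least three points, no
    extra slope is prescribed.\<close>
  obtain KA where KA: "finite KA" "card KA = 3 - card D" "KA \<inter> sl ` D = {}"
    using fresh_points[of "sl ` D"] finT by blast
  have "card KA + card {} < tdim (forms_through_mult 3 Z (3 - 1) q)"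
    using N[OF st(2)] KA(2) by auto
  from killed_pair[OF _ st(3) _ KA(1) _ this] h(2)[OF h0] obtain A B where
    AB: "degree A \<le> 2" "degree B \<le> 3" "A \<noteq> 0 \<or> B \<noteq> 0" "incident s t A B" "\<forall>c\<in>KA. poly A c = 0"
    by auto
  have inc: "(xc p - s) * poly B (sl p) + poly A (sl p) = 0" if "p \<in> Z" for p
    using AB(4) that by (auto simp: pts_def sl_def)
  have slX: "(xc p - s) * (sl p - k) = e + (yc p - (k * xc p + m))" if "p \<in> Z" for p
  proof -
    have "(xc p - s) * sl p = yc p - t" using xs[OF that] by (simp add: sl_def)
    then show ?thesis by (simp add: e_def algebra_simps)
  qed
  \<comment> \<open>Up to the factor \<open>c - k\<close>, this is the restriction of the cubic to
    the line \<open>y = k * x + m\<close>, parametrized by the slope \<open>c\<close> from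
    \<open>q\<close>. It has four roots and degree at most 3.\<close>
  define H where "H = smult e B + [:- k, 1:] * A"
  have H: "poly H c = e * poly B c + (c - k) * poly A c" for c by (simp add: H_def algebra_simps)
  have "H = 0"
  proof (rule poly_eq_0_if_roots[of H 3 "sl ` T"])
    show "degree H \<le> 3" unfolding H_def using AB(1,2)
      by (intro degree_add_le order.trans[OF degree_smult_le] order.trans[OF degree_mult_le]) auto
    have "inj_on sl T" using inj_on_subset[OF inj_sl] T(1) by (auto simp: L_def)
    then show "3 < card (sl ` T)" using T(2) by (simp add: card_image)
    show "finite (sl ` T)" using finT by simp
    fix c assume "c \<in> sl ` T"
    then obtain p where p: "p \<in> Z" "yc p = k * xc p + m" "c = sl p" using T(1) by (auto simp: L_def)
    have "poly H c = (xc p - s) * (sl p - k) * poly B c + (c - k) * poly A c"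
      using slX[OF p(1)] p(2) by (simp add: H)
    also have "\<dots> = (sl p - k) * ((xc p - s) * poly B (sl p) + poly A (sl p))"
      by (simp add: p(3) algebra_simps)
    finally show "poly H c = 0" using inc[OF p(1)] by simp
  qed
  \<comment> \<open>With the line split off, the incidence at a point of \<open>D\<close> becomes
    \<open>A\<close> times the equation of the line, which is nonzero there.\<close>
  have "poly A c = 0" if c: "c \<in> sl ` D" for c
  proof -
    obtain p where p: "p \<in> Z" "yc p \<noteq> k * xc p + m" "c = sl p" using c by (auto simp: D_def L_def)
    have "e * poly B c + (c - k) * poly A c = 0" using H[of c] \<open>H = 0\<close> by simp
    then have eB: "e * poly B c = - ((c - k) * poly A c)" by (simp only: eq_neg_iff_add_eq_0)
    have "e * ((xc p - s) * poly B c + poly A c) = (xc p - s) * (e * poly B c) + e * poly A c"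
      by (simp add: algebra_simps)
    also have "\<dots> = (xc p - s) * (- ((c - k) * poly A c)) + e * poly A c" unfolding eB ..
    also have "\<dots> = (e - (xc p - s) * (sl p - k)) * poly A c" by (simp add: p(3) algebra_simps)
    also have "\<dots> = - (yc p - (k * xc p + m)) * poly A c" unfolding slX[OF p(1)] by simp
    finally show ?thesis using inc[OF p(1)] p(2,3) by simp
  qed
  then have "A = 0"
  proof (intro poly_eq_0_if_roots[of A 2 "KA \<union> sl ` D"])
    have "card (sl ` D) = card D" using inj_on_subset[OF inj_sl] by (intro card_image) (auto simp: D_def)
    then show "2 < card (KA \<union> sl ` D)" using KA finT by (simp add: card_Un_disjoint)
  qed (use AB KA finT in auto)
  then have "B = 0" using \<open>H = 0\<close> e0 by (simp add: H_def)
  with \<open>A = 0\<close> AB(3) show False by simp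
qed

text \<open>The equation of the line is homogenized and transported to the standard coordinates by
  \<open>dual\<close>.\<close>

lemma collinear_chart:
  assumes "at_most_collinear 3 Z"
  shows "card {p \<in> Z. yc p = k * xc p + m} \<le> 3"
proof -
  obtain a where a: "\<And>X Y z. (\<Sum>i\<in>UNIV. a $ i * E X Y z $ i) = - m * z + - k * X + 1 * Y" using dual by blast
  have "a \<noteq> 0" using a[of 0 1 0] by auto
  then obtain u where u: "a \<in> coords u" using coords_exists by blast
  have "{p \<in> Z. yc p = k * xc p + m} \<subseteq> Z \<inter> dual_line u"
  proof safe
    fix p assume p: "p \<in> Z" "yc p = k * xc p + m"
    have s: "(\<Sum>i\<in>UNIV. a $ i * E (xc p) (yc p) 1 $ i) = 0" unfolding a using p(2) by simp
    show "p \<in> dual_line u" unfolding dual_line_def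
    proof safe
      fix b v assume "b \<in> coords u" "v \<in> coords p"
      then obtain c d where "b = c *s a" "v = d *s E (xc p) (yc p) 1"
        using coords_iff[OF u] coords_iff[OF rep[OF p(1)]] by blast
      then have "(\<Sum>i\<in>UNIV. b $ i * v $ i) = c * d * (\<Sum>i\<in>UNIV. a $ i * E (xc p) (yc p) 1 $ i)"
        by (simp add: sum_distrib_left algebra_simps)
      then show "(\<Sum>i\<in>UNIV. b $ i * v $ i) = 0" using s by simp
    qed
  qed
  then have "card {p \<in> Z. yc p = k * xc p + m} \<le> card (Z \<inter> dual_line u)"
    using fin by (intro card_mono) auto
  also have "\<dots> \<le> 3" using assms by (auto simp: at_most_collinear_def proj_lines_def)
  finally show ?thesis .
qed

end

section \<open>Collinear points and the dual arrangement\<close>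

lemma mem_dual_line:
  assumes "a \<in> coords p" "v \<in> coords x"
  shows "x \<in> dual_line p \<longleftrightarrow> (\<Sum>i\<in>UNIV. a $ i * v $ i) = 0"
proof
  assume s: "(\<Sum>i\<in>UNIV. a $ i * v $ i) = 0"
  show "x \<in> dual_line p" unfolding dual_line_def
  proof safe
    fix b w assume "b \<in> coords p" "w \<in> coords x"
    then obtain c d where "b = c *s a" "w = d *s v" using coords_iff assms by metis
    then have "(\<Sum>i\<in>UNIV. b $ i * w $ i) = c * d * (\<Sum>i\<in>UNIV. a $ i * v $ i)"
      by (simp add: sum_distrib_left algebra_simps)
    then show "(\<Sum>i\<in>UNIV. b $ i * w $ i) = 0" using s by simp
  qed
qed (use assms in \<open>auto simp: dual_line_def\<close>)

lemma dual_line_sym: "x \<in> dual_line p \<longleftrightarrow> p \<in> dual_line x"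
proof -
  obtain a v where "a \<in> coords p" "v \<in> coords x" using coords_nonempty by metis
  then show ?thesis using mem_dual_line[of a p v x] mem_dual_line[of v x a p] by (simp add: mult.commute)
qed

text \<open>Three vectors orthogonal to \<open>a\<close> suffice: up to sign their pairings with
  \<open>b\<close> are the 2 by 2 minors of \<open>a\<close> and \<open>b\<close>.\<close>

lemma inj_dual_line: "inj dual_line"
proof (rule injI)
  fix p q assume eq: "dual_line p = dual_line q"
  obtain a b where ab: "a \<in> coords p" "b \<in> coords q" using coords_nonempty by metis
  have z: "(\<Sum>i\<in>UNIV. b $ i * v $ i) = 0" if "(\<Sum>i\<in>UNIV. a $ i * v $ i) = 0" for v
  proof (cases "v = 0")
    case False
    then obtain x where "v \<in> coords x" using coords_exists by blast
    then show ?thesis using that eq mem_dual_line ab by blast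
  qed simp
  have c: "a $ 1 * b $ 2 = a $ 2 * b $ 1" "a $ 1 * b $ 3 = a $ 3 * b $ 1" "a $ 2 * b $ 3 = a $ 3 * b $ 2"
    using z[of "vector [- a $ 2, a $ 1, 0]"] z[of "vector [- a $ 3, 0, a $ 1]"] z[of "vector [0, - a $ 3, a $ 2]"]
    by (simp_all add: sum_3 algebra_simps)
  obtain i where i: "a $ i \<noteq> 0" using coords_nonzero[OF ab(1)] by (auto simp: vec_eq_iff)
  have "\<forall>j. a $ i * b $ j = a $ j * b $ i"
    using c exhaust_3[of i] by (auto simp: forall_3 algebra_simps)
  then have "b = (b $ i / a $ i) *s a" using i by (simp add: vec_eq_iff field_simps)
  then have "b \<in> coords p" using coords_iff[OF ab(1)] coords_nonzero[OF ab(2)] by blast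
  then show "p = q" using coords_inject ab(2) by blast
qed

text \<open>By the symmetry of incidence, the lines of the arrangement through \<open>x\<close>
  correspond to the points of \<open>Z\<close> on the line dual to \<open>x\<close>. Where fewer
  than two lines pass, there is no intersection point, and the bound holds because
  \<open>1 \<le> k\<close>.\<close>

lemma at_most_collinear_iff:
  assumes "finite Z" "1 \<le> k"
  shows "at_most_collinear k Z \<longleftrightarrow> max_mult (dual_arrangement Z) \<le> k"
proof -
  let ?A = "dual_arrangement Z"
  have pm: "point_mult ?A x = card (Z \<inter> dual_line x)" for x
  proof -
    have "{l \<in> ?A. x \<in> l} = dual_line ` (Z \<inter> dual_line x)"
      using dual_line_sym by (auto simp: dual_arrangement_def)
    then show ?thesis
      by (simp add: point_mult_def card_image inj_on_subset[OF inj_dual_line])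
  qed
  have ip: "x \<in> intersection_points ?A \<longleftrightarrow> 2 \<le> card (Z \<inter> dual_line x)" for x
  proof -
    have "x \<in> intersection_points ?A \<longleftrightarrow> (\<exists>p\<in>Z \<inter> dual_line x. \<exists>q\<in>Z \<inter> dual_line x. p \<noteq> q)"
      using dual_line_sym inj_dual_line
      by (auto simp: intersection_points_def dual_arrangement_def inj_eq)
    also have "\<dots> \<longleftrightarrow> \<not> card (Z \<inter> dual_line x) \<le> Suc 0"
      using assms(1) by (subst card_le_Suc0_iff_eq) auto
    finally show ?thesis by auto
  qed
  let ?M = "point_mult ?A ` intersection_points ?A"
  have finM: "finite ?M"
    by (rule finite_subset[of _ "{..card Z}"]) (use assms(1) in \<open>auto simp: pm intro: card_mono\<close>)
  have "max_mult ?A \<le> k \<longleftrightarrow> (\<forall>n\<in>?M. n \<le> k)"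
  proof (cases "?M = {}")
    case True
    then show ?thesis by (simp add: max_mult_def)
  next
    case False
    then show ?thesis using finM by (simp add: max_mult_def cSup_eq_Max)
  qed
  also have "\<dots> \<longleftrightarrow> (\<forall>x. 2 \<le> card (Z \<inter> dual_line x) \<longrightarrow> card (Z \<inter> dual_line x) \<le> k)"
    using ip pm by auto
  also have "\<dots> \<longleftrightarrow> at_most_collinear k Z"
  proof -
    have "(2 \<le> n \<longrightarrow> n \<le> k) \<longleftrightarrow> n \<le> k" for n :: nat using assms(2) by linarith
    then show ?thesis by (simp add: at_most_collinear_def proj_lines_def)
  qed
  finally show ?thesis by blast
qed

theorem proposition3p7:
  fixes Z :: "cp2 set"
  assumes "finite Z"
  shows "(at_most_collinear 3 Z \<longleftrightarrow> max_mult (dual_arrangement Z) \<le> 3)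
    \<and> (at_most_collinear 3 Z \<longrightarrow> (\<forall>j. \<not> admits_unexpected Z j))
    \<and> \<not> admits_unexpected Z 3"
proof -
  obtain e1 e2 e3 xc yc where "chart Z e1 e2 e3 xc yc" using chart_exists[OF assms] by blast
  then interpret chart Z e1 e2 e3 xc yc "\<lambda>X Y z. X *s e1 + Y *s e2 + z *s e3" .
  have "\<not> admits_unexpected Z 3"
  \<comment> \<open>Only non-vertical lines of the chart matter, as its vertical lines contain at
    most one point of \<open>Z\<close>.\<close>
  proof (cases "\<exists>k m. 4 \<le> card {p \<in> Z. yc p = k * xc p + m}")
    case True
    then show ?thesis using no_unexpected_cubic by blast
  next
    case False
    have "card {p \<in> Z. yc p = k * xc p + m} \<le> 3" for k m
    proof -
      have "\<not> 4 \<le> card {p \<in> Z. yc p = k * xc p + m}" using False by blast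
      then show ?thesis by linarith
    qed
    then show ?thesis by (rule no_unexpected)
  qed
  then show ?thesis
    using at_most_collinear_iff[OF assms, of 3] no_unexpected[OF collinear_chart] by simp
qed

end
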